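(* Let $G$ be a countably infinite group, let $b:G\to(\mathbb{R},+)$ be a nonzero homomorphism, and let $d:=b^2$. Let $x_0\in F^2(G)$ and $y_0\in F^3(G)$. For $t\ge 0$, set $$u_1(t):=t\cdot S_b(y_0),\qquad u_2(t):=\frac{M_t^b(x_0)+M_{-t}^b(x_0)}{2},\qquad u_3(t):=\frac{M_t^b(T_b(y_0))-M_{-t}^b(T_b(y_0))}{2i},$$ and $u(t):=u_1(t)+u_2(t)+u_3(t)$. Then $u:[0,\infty)\to C_r^*(G)$ is a solution to the wave problem on $C_r^*(G)$ associated to $H_d^{\mathcal{D}}$ and $x_0,y_0$.
   Context: $\lambda$ is the left regular representation of $G$ on $\ell^2(G)$, $(\lambda(g)\xi)(h)=\xi(g^{-1}h)$; $\{\delta_h\}_{h\in G}$ is the canonical basis of $\ell^2(G)$ and $e$ is the identity of $G$. $C_r^*(G)$ is the closure of $\mathrm{Span}(\lambda(G))$ in $B(\ell^2(G))$ for the operator norm $\|\cdot\|$. For $x\in C_r^*(G)$, the Fourier transform is $\widehat{x}:=x\delta_e\in\ell^2(G)$, with Fourier coefficients $\widehat{x}(g)$, $g\in G$. A series $\sum_{s\in S}x_s$ in a normed space converges to $x$ if the net of its finite partial sums, indexed by the finite subsets of $S$ directed by inclusion, converges to $x$ (unordered convergence). All series below are understood in this sense with respect to $\|\cdot\|$. $CF(G)$ is the set of $x\in C_r^*(G)$ for which $\sum_{g\in G}\widehat{x}(g)\lambda(g)$ is convergent w.r.t. $\|\cdot\|$ (the sum is then necessarily $x$). $\{M_t^b\}_{t\in\mathbb{R}}$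 is the one-parameter group of $*$-automorphisms of $C_r^*(G)$ with $M_t^b(\lambda(g))=e^{itb(g)}\lambda(g)$ for all $g\in G$, $t\in\mathbb{R}$; the map $t\mapsto M_t^b(x)$ is norm-continuous for every $x\in C_r^*(G)$. Let $\mathcal{C}=\{x\in C_r^*(G):\lim_{t\to0}\frac{M_t^b(x)-x}{t}\text{ exists in }C_r^*(G)\}$, and let $\delta_b^{\mathcal{C}}:\mathcal{C}\to C_r^*(G)$, $\delta_b^{\mathcal{C}}(x)=\lim_{t\to0}\frac{M_t^b(x)-x}{t}$, be the infinitesimal generator. For $n\in\mathbb{N}=\{1,2,\dots\}$, $F^n(G)$ is the set of $x\in C_r^*(G)$ such that, for every $k=0,1,\dots,n$, both $\sum_{g\in G}b(g)^k\widehat{x}(g)\lambda(g)$ and $\sum_{g\notin\ker(b)}b(g)^{-k}\widehat{x}(g)\lambda(g)$ are convergent w.r.t. $\|\cdot\|$ (with $b(g)^0=1$ for all $g$). $T_b:F^1(G)\to C_r^*(G)$ is $T_b(x)=\sum_{g\notin\ker(b)}b(g)^{-1}\widehat{x}(g)\lambda(g)$. $S_b:CF(G)\to C_r^*(G)$ is $S_b(x)=\sum_{g\in\ker(b)}\widehat{x}(g)\lambda(g)$. $\mathcal{D}:=F^2(G)$ and $H_d^{\mathcal{D}}:=\delta_b^{\mathcal{C}}\circ\delta_b^{\mathcal{C}}:\mathcal{D}\to C_r^*(G)$ (the composition is well-defined, since $F^1(G)\subseteq\mathcal{C}$ and $\delta_b^{\mathcal{C}}(F^2(G))\subseteq F^1(G)$).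 A function $u:[0,\infty)\to C_r^*(G)$ is a solution of the wave problem on $C_r^*(G)$ associated to $H_d^{\mathcal{D}}$ and $x_0,y_0\in C_r^*(G)$ if: $u(0)=x_0$; $u(t)\in\mathcal{D}$ for every $t>0$; $u$ is twice differentiable on $(0,\infty)$ (derivatives being limits in the operator norm) and $u''(t)=H_d^{\mathcal{D}}(u(t))$ for every $t>0$; $\lim_{t\to0^+}\|u(t)-x_0\|=0$; and $\lim_{t\to0^+}\|u'(t)-y_0\|=0$. *)

theory Defs
  imports "HOL-Analysis.Analysis"
begin

section \<open>The Hilbert space of square-summable functions\<close>

typedef 'g ell2 = "{f :: 'g \<Rightarrow> complex. (\<lambda>h. (cmod (f h))\<^sup>2) summable_on UNIV}"
  morphisms coord Abs_ell2
  by (rule exI[of _ "\<lambda>_. 0"]) simp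

setup_lifting type_definition_ell2

lemma ell2_mult_summable:
  assumes "(\<lambda>h. (cmod (f h))\<^sup>2) summable_on UNIV" "(\<lambda>h. (cmod (k h))\<^sup>2) summable_on UNIV"
  shows "(\<lambda>h. f h * cnj (k h)) summable_on UNIV"
proof -
  have "(\<lambda>h. norm (f h * cnj (k h))) summable_on UNIV"
  proof (rule summable_on_comparison_test)
    show "(\<lambda>h. (cmod (f h))\<^sup>2 + (cmod (k h))\<^sup>2) summable_on UNIV"
      by (rule summable_on_add[OF assms])
    show "norm (f h * cnj (k h)) \<le> (cmod (f h))\<^sup>2 + (cmod (k h))\<^sup>2" for h
    proof -
      have "2 * (cmod (f h) * cmod (k h)) \<le> (cmod (f h))\<^sup>2 + (cmod (k h))\<^sup>2"
        using sum_squares_bound[of "cmod (f h)" "cmod (k h)"] by simp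
      moreover have "0 \<le> cmod (f h) * cmod (k h)"
        by simp
      ultimately show ?thesis
        unfolding norm_mult complex_mod_cnj by linarith
    qed
  qed auto
  then show ?thesis
    by (rule abs_summable_summable)
qed

lemma ell2_add_summable:
  assumes "(\<lambda>h. (cmod (f h))\<^sup>2) summable_on UNIV" "(\<lambda>h. (cmod (k h))\<^sup>2) summable_on UNIV"
  shows "(\<lambda>h. (cmod (f h + k h))\<^sup>2) summable_on UNIV"
proof (rule summable_on_comparison_test)
  show "(\<lambda>h. 2 * ((cmod (f h))\<^sup>2 + (cmod (k h))\<^sup>2)) summable_on UNIV"
    by (intro summable_on_cmult_right summable_on_add assms)
  show "(cmod (f h + k h))\<^sup>2 \<le> 2 * ((cmod (f h))\<^sup>2 + (cmod (k h))\<^sup>2)" for h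
  proof -
    have "(cmod (f h + k h))\<^sup>2 \<le> (cmod (f h) + cmod (k h))\<^sup>2"
      by (intro power_mono norm_triangle_ineq) simp
    also have "\<dots> \<le> 2 * ((cmod (f h))\<^sup>2 + (cmod (k h))\<^sup>2)"
      using sum_squares_bound[of "cmod (f h)" "cmod (k h)"]
      by (simp add: power2_sum)
    finally show ?thesis .
  qed
qed auto

lemma ell2_scale_summable:
  assumes "(\<lambda>h. (cmod (f h))\<^sup>2) summable_on UNIV"
  shows "(\<lambda>h. (cmod (c * f h))\<^sup>2) summable_on UNIV"
  using summable_on_cmult_right[OF assms, of "(cmod c)\<^sup>2"]
  by (simp add: norm_mult power_mult_distrib)

lift_definition cscale :: "complex \<Rightarrow> 'g ell2 \<Rightarrow> 'g ell2" is "\<lambda>c f h. c * f h"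
  by (rule ell2_scale_summable)

lift_definition cinner :: "'g ell2 \<Rightarrow> 'g ell2 \<Rightarrow> complex"
  is "\<lambda>f k. \<Sum>\<^sub>\<infinity>h. f h * cnj (k h)" .

lemma has_sum_cinner: "((\<lambda>h. coord x h * cnj (coord y h)) has_sum cinner x y) UNIV"
  by transfer (simp add: ell2_mult_summable)

lemma ell2_eqI: "(\<And>h. coord x h = coord y h) \<Longrightarrow> x = y"
  by (metis coord_inject ext)

text \<open>The real inner product is the real part of \<^const>\<open>cinner\<close>; it induces the same norm.\<close>

instantiation ell2 :: (type) real_inner
begin

lift_definition zero_ell2 :: "'a ell2" is "\<lambda>_. 0" by simp

lift_definition plus_ell2 :: "'a ell2 \<Rightarrow> 'a ell2 \<Rightarrow> 'a ell2" is "\<lambda>f k h. f h + k h"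
  by (rule ell2_add_summable)

lift_definition uminus_ell2 :: "'a ell2 \<Rightarrow> 'a ell2" is "\<lambda>f h. - f h" by simp

definition minus_ell2 :: "'a ell2 \<Rightarrow> 'a ell2 \<Rightarrow> 'a ell2" where
  "x - y = x + - (y :: 'a ell2)"

definition scaleR_ell2 :: "real \<Rightarrow> 'a ell2 \<Rightarrow> 'a ell2" where
  "r *\<^sub>R x = cscale (of_real r) (x :: 'a ell2)"

definition inner_ell2 :: "'a ell2 \<Rightarrow> 'a ell2 \<Rightarrow> real" where
  "x \<bullet> y = Re (cinner x (y :: 'a ell2))"

definition norm_ell2 :: "'a ell2 \<Rightarrow> real" where
  "norm x = sqrt (x \<bullet> (x :: 'a ell2))"

definition dist_ell2 :: "'a ell2 \<Rightarrow> 'a ell2 \<Rightarrow> real" where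
  "dist x y = norm (x - (y :: 'a ell2))"

definition sgn_ell2 :: "'a ell2 \<Rightarrow> 'a ell2" where
  "sgn x = inverse (norm x) *\<^sub>R (x :: 'a ell2)"

definition uniformity_ell2 :: "('a ell2 \<times> 'a ell2) filter" where
  "uniformity_ell2 = (INF e\<in>{0<..}. principal {(x :: 'a ell2, y). dist x y < e})"

definition open_ell2 :: "'a ell2 set \<Rightarrow> bool" where
  "open_ell2 U \<longleftrightarrow> (\<forall>x\<in>U. \<forall>\<^sub>F (x', y) in uniformity. x' = x \<longrightarrow> y \<in> (U :: 'a ell2 set))"

instance
proof
  fix x y z :: "'a ell2" and r s :: real
  show "x + y + z = x + (y + z)" "x + y = y + x" "0 + x = x" "- x + x = 0"
    by (transfer; simp add: add_ac)+
  show "x - y = x + - y" "dist x y = norm (x - y)" "sgn x = inverse (norm x) *\<^sub>R x"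
    by (simp_all add: minus_ell2_def dist_ell2_def sgn_ell2_def)
  show "r *\<^sub>R (x + y) = r *\<^sub>R x + r *\<^sub>R y" "(r + s) *\<^sub>R x = r *\<^sub>R x + s *\<^sub>R x"
    "r *\<^sub>R s *\<^sub>R x = (r * s) *\<^sub>R x" "1 *\<^sub>R x = x"
    unfolding scaleR_ell2_def by (transfer; simp add: algebra_simps)+
  show "uniformity = (INF e\<in>{0<..}. principal {(x :: 'a ell2, y). dist x y < e})"
    by (rule uniformity_ell2_def)
  show "open U \<longleftrightarrow> (\<forall>x\<in>U. \<forall>\<^sub>F (x', y) in uniformity. x' = x \<longrightarrow> y \<in> U)" for U :: "'a ell2 set"
    by (rule open_ell2_def)
  show "norm x = sqrt (x \<bullet> x)"
    by (rule norm_ell2_def)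
  have "cinner y x = cnj (cinner x y)"
    by (transfer, subst infsum_cnj[symmetric]) (simp add: mult.commute)
  then show "x \<bullet> y = y \<bullet> x"
    by (simp add: inner_ell2_def)
  have "cinner (x + y) z = cinner x z + cinner y z"
    by transfer (simp add: distrib_right infsum_add ell2_mult_summable)
  then show "(x + y) \<bullet> z = x \<bullet> z + y \<bullet> z"
    by (simp add: inner_ell2_def)
  have "cinner (r *\<^sub>R x) y = of_real r * cinner x y"
    unfolding scaleR_ell2_def
    by transfer (simp add: mult.assoc infsum_cmult_right')
  then show "(r *\<^sub>R x) \<bullet> y = r * (x \<bullet> y)"
    by (simp add: inner_ell2_def)
  have *: "((\<lambda>h. (cmod (coord x h))\<^sup>2) has_sum x \<bullet> x) UNIV"
    using has_sum_Re[OF has_sum_cinner[of x x]]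
    unfolding inner_ell2_def complex_norm_square[symmetric] by simp
  show "0 \<le> x \<bullet> x"
    by (rule has_sum_nonneg[OF *]) simp
  show "x \<bullet> x = 0 \<longleftrightarrow> x = 0"
  proof
    assume "x \<bullet> x = 0"
    then have "(cmod (coord x h))\<^sup>2 = 0" for h
      using nonneg_has_sum_le_0D[OF *, of h] by simp
    then show "x = 0"
      by (intro ell2_eqI) (simp add: zero_ell2.rep_eq)
  next
    assume "x = 0"
    then have "((\<lambda>h :: 'a. 0 :: real) has_sum x \<bullet> x) UNIV"
      using * by (simp add: zero_ell2.rep_eq)
    then show "x \<bullet> x = 0"
      by (metis has_sum_0_simp has_sum_unique)
  qed
qed

end

lemma coord_plus: "coord (x + y) h = coord x h + coord y h"
  by (simp add: plus_ell2.rep_eq)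

lemma coord_uminus: "coord (- x) h = - coord x h"
  by (simp add: uminus_ell2.rep_eq)

lemma coord_minus: "coord (x - y) h = coord x h - coord y h"
  unfolding minus_ell2_def coord_plus coord_uminus by simp

lemma coord_scaleR: "coord (r *\<^sub>R x) h = of_real r * coord x h"
  by (simp add: scaleR_ell2_def cscale.rep_eq)

lemma coord_cscale: "coord (cscale c x) h = c * coord x h"
  by (simp add: cscale.rep_eq)

lemma has_sum_norm_ell2: "((\<lambda>h. (cmod (coord x h))\<^sup>2) has_sum (norm x)\<^sup>2) UNIV"
proof -
  have "(norm x)\<^sup>2 = x \<bullet> x"
    by (simp add: power2_norm_eq_inner)
  then show ?thesis
    using has_sum_Re[OF has_sum_cinner[of x x]]
    unfolding inner_ell2_def complex_norm_square[symmetric] by simp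
qed

lemma norm_ell2_eq: "norm x = sqrt (\<Sum>\<^sub>\<infinity>h. (cmod (coord x h))\<^sup>2)"
  using has_sum_norm_ell2[of x] by (simp add: infsumI)

lemma norm_cscale: "norm (cscale c x) = cmod c * norm x"
  by (simp add: norm_ell2_eq coord_cscale norm_mult power_mult_distrib infsum_cmult_right'
      real_sqrt_mult)

lemma norm_coord_le: "cmod (coord x h) \<le> norm x"
proof -
  have "(\<Sum>h\<in>{h}. (cmod (coord x h))\<^sup>2) \<le> (norm x)\<^sup>2"
    by (rule finite_sum_le_has_sum[OF has_sum_norm_ell2]) auto
  then have "(cmod (coord x h))\<^sup>2 \<le> (norm x)\<^sup>2"
    by simp
  then show ?thesis
    by (rule power2_le_imp_le) simp
qed

instance ell2 :: (type) banach
proof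
  fix X :: "nat \<Rightarrow> 'a ell2"
  assume X: "Cauchy X"
  have "convergent (\<lambda>n. coord (X n) h)" for h
  proof (rule Cauchy_convergent, rule metric_CauchyI)
    fix e :: real assume "0 < e"
    then obtain M where M: "\<And>m n. m \<ge> M \<Longrightarrow> n \<ge> M \<Longrightarrow> dist (X m) (X n) < e"
      using metric_CauchyD[OF X] by blast
    have "dist (coord (X m) h) (coord (X n) h) < e" if "m \<ge> M" "n \<ge> M" for m n
      using M[OF that] norm_coord_le[of "X m - X n" h]
      by (simp add: dist_norm coord_minus)
    then show "\<exists>M. \<forall>m\<ge>M. \<forall>n\<ge>M. dist (coord (X m) h) (coord (X n) h) < e"
      by blast
  qed
  then obtain f where f: "\<And>h. (\<lambda>n. coord (X n) h) \<longlonglongrightarrow> f h"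
    unfolding convergent_def by metis
  have fin: "(\<Sum>h\<in>F. (cmod (coord (X n) h - f h))\<^sup>2) \<le> e\<^sup>2"
    if M: "\<And>m n. m \<ge> M \<Longrightarrow> n \<ge> M \<Longrightarrow> dist (X m) (X n) < e" and "n \<ge> M" "finite F" for M e n F
  proof (rule tendsto_upperbound)
    show "(\<lambda>m. \<Sum>h\<in>F. (cmod (coord (X n) h - coord (X m) h))\<^sup>2)
        \<longlonglongrightarrow> (\<Sum>h\<in>F. (cmod (coord (X n) h - f h))\<^sup>2)"
      by (intro tendsto_intros f)
    show "\<forall>\<^sub>F m in sequentially. (\<Sum>h\<in>F. (cmod (coord (X n) h - coord (X m) h))\<^sup>2) \<le> e\<^sup>2"
      unfolding eventually_sequentially
    proof (intro exI allI impI)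
      fix m assume "m \<ge> M"
      have "(\<Sum>h\<in>F. (cmod (coord (X n - X m) h))\<^sup>2) \<le> (norm (X n - X m))\<^sup>2"
        by (rule finite_sum_le_has_sum[OF has_sum_norm_ell2]) (use \<open>finite F\<close> in auto)
      also have "\<dots> \<le> e\<^sup>2"
        using M[OF \<open>n \<ge> M\<close> \<open>m \<ge> M\<close>] by (intro power_mono) (auto simp: dist_norm)
      finally show "(\<Sum>h\<in>F. (cmod (coord (X n) h - coord (X m) h))\<^sup>2) \<le> e\<^sup>2"
        by (simp add: coord_minus)
    qed
  qed simp
  have diff: "(\<lambda>h. (cmod (coord (X n) h - f h))\<^sup>2) summable_on UNIV"
    if M: "\<And>m n. m \<ge> M \<Longrightarrow> n \<ge> M \<Longrightarrow> dist (X m) (X n) < e" and "n \<ge> M" for M e n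
    by (rule nonneg_bdd_above_summable_on)
      (auto intro!: bdd_aboveI2[where M = "e\<^sup>2"] fin[OF M \<open>n \<ge> M\<close>])
  obtain N where N: "\<And>m n. m \<ge> N \<Longrightarrow> n \<ge> N \<Longrightarrow> dist (X m) (X n) < 1"
    using metric_CauchyD[OF X, of 1] by auto
  have "(\<lambda>h. (cmod (coord (X N) h - f h))\<^sup>2) summable_on UNIV"
    by (rule diff[OF N]) auto
  then have "(\<lambda>h. (cmod (f h - coord (X N) h))\<^sup>2) summable_on UNIV"
    by (simp add: norm_minus_commute)
  from ell2_add_summable[OF this has_sum_imp_summable[OF has_sum_norm_ell2[of "X N"]]]
  have "(\<lambda>h. (cmod (f h))\<^sup>2) summable_on UNIV"
    by simp
  then have L: "coord (Abs_ell2 f) = f"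
    by (simp add: Abs_ell2_inverse)
  have "X \<longlonglongrightarrow> Abs_ell2 f"
  proof (rule metric_LIMSEQ_I)
    fix r :: real assume "0 < r"
    then obtain M where M: "\<And>m n. m \<ge> M \<Longrightarrow> n \<ge> M \<Longrightarrow> dist (X m) (X n) < r / 2"
      using metric_CauchyD[OF X, of "r / 2"] by auto
    have "dist (X n) (Abs_ell2 f) < r" if "n \<ge> M" for n
    proof -
      have "((\<lambda>h. (cmod (coord (X n) h - f h))\<^sup>2) has_sum (norm (X n - Abs_ell2 f))\<^sup>2) UNIV"
        using has_sum_norm_ell2[of "X n - Abs_ell2 f"] by (simp add: coord_minus L)
      then have "(norm (X n - Abs_ell2 f))\<^sup>2 \<le> (r / 2)\<^sup>2"
        by (rule has_sum_le_finite_sums) (rule fin[OF M that])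
      then have "norm (X n - Abs_ell2 f) \<le> r / 2"
        by (rule power2_le_imp_le) (use \<open>0 < r\<close> in simp)
      then show ?thesis
        using \<open>0 < r\<close> by (simp add: dist_norm)
    qed
    then show "\<exists>M. \<forall>n\<ge>M. dist (X n) (Abs_ell2 f) < r"
      by blast
  qed
  then show "convergent X"
    by (rule convergentI)
qed

lift_definition basis :: "'g \<Rightarrow> 'g ell2" is "\<lambda>g h. if h = g then 1 else 0"
  by (rule finite_nonzero_values_imp_summable_on) auto

section \<open>Bounded operators\<close>

text \<open>
  \<^typ>\<open>'g ell2 \<Rightarrow>\<^sub>L 'g ell2\<close> consists of the bounded \<^emph>\<open>real\<close>-linear operators. The complex-linear ones
  form a closed subspace of it, with the same operator norm, which contains every operator
  considered below.
\<close>

type_synonym 'g op = "'g ell2 \<Rightarrow>\<^sub>L 'g ell2"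

lemma bounded_linear_cscale: "bounded_linear (cscale c)"
  by (rule bounded_linear_intro[where K = "cmod c"])
    (auto intro!: ell2_eqI simp: coord_cscale coord_plus coord_scaleR norm_cscale algebra_simps)

definition cscale_op :: "complex \<Rightarrow> 'g op \<Rightarrow> 'g op" where
  "cscale_op c T = Blinfun (\<lambda>x. cscale c (T x))"

lemma cscale_op_apply: "cscale_op c T x = cscale c (T x)"
  unfolding cscale_op_def
  by (simp add: bounded_linear_Blinfun_apply
      bounded_linear_compose[OF bounded_linear_cscale blinfun.bounded_linear_right])

interpretation cop: vector_space "cscale_op :: complex \<Rightarrow> 'g op \<Rightarrow> 'g op"
proof
  fix c d :: complex and T U :: "'g op"
  show "cscale_op c (T + U) = cscale_op c T + cscale_op c U"
    "cscale_op (c + d) T = cscale_op c T + cscale_op d T"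
    "cscale_op c (cscale_op d T) = cscale_op (c * d) T"
    "cscale_op 1 T = T"
    by (rule blinfun_eqI ell2_eqI;
        simp add: cscale_op_apply coord_cscale blinfun.add_left coord_plus algebra_simps)+
qed

definition adj :: "'g op \<Rightarrow> 'g op" where
  "adj T = (THE S :: 'g op. \<forall>x y. cinner (T x) y = cinner x (S y))"

section \<open>The reduced group C*-algebra\<close>

text \<open>
  Groups are written additively, as prescribed by the class \<^class>\<open>group_add\<close>, which does not
  assume commutativity: the identity is 0 and $g^{-1}h$ is written \<open>- g + h\<close>.
\<close>

lemma bij_left_translation: "bij (\<lambda>h. - g + h)" for g :: "'g::group_add"
proof (rule bijI)
  show "inj (\<lambda>h. - g + h)"
    by (rule injI) simp
  show "surj (\<lambda>h. - g + h)"
    by (rule surjI[where f = "\<lambda>h. g + h"]) (simp only: minus_add_cancel)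
qed

lemma ltrans_summable:
  fixes g :: "'g::group_add" and f :: "'g \<Rightarrow> complex"
  assumes "(\<lambda>h. (cmod (f h))\<^sup>2) summable_on UNIV"
  shows "(\<lambda>h. (cmod (f (- g + h)))\<^sup>2) summable_on UNIV"
  using assms
    summable_on_reindex_bij_betw[OF bij_left_translation, of "\<lambda>h. (cmod (f h))\<^sup>2" g]
  by (rule iffD2[rotated])

lift_definition ltrans :: "'g::group_add \<Rightarrow> 'g ell2 \<Rightarrow> 'g ell2" is "\<lambda>g f h. f (- g + h)"
  by (rule ltrans_summable)

lemma norm_ltrans: "norm (ltrans g x) = norm x"
  using infsum_reindex_bij_betw[OF bij_left_translation, of "\<lambda>h. (cmod (coord x h))\<^sup>2" g]
  by (simp add: norm_ell2_eq ltrans.rep_eq)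

lemma bounded_linear_ltrans: "bounded_linear (ltrans g)"
  by (rule bounded_linear_intro[where K = 1])
    (auto intro!: ell2_eqI simp: ltrans.rep_eq coord_plus coord_scaleR norm_ltrans)

definition lreg :: "'g::group_add \<Rightarrow> 'g op" where
  "lreg g = Blinfun (ltrans g)"

lemma lreg_apply: "lreg g x = ltrans g x"
  by (simp add: lreg_def bounded_linear_Blinfun_apply bounded_linear_ltrans)

definition Cr :: "'g::group_add op set" where
  "Cr = closure (cop.span (range lreg))"

definition fourier :: "'g::group_add op \<Rightarrow> 'g \<Rightarrow> complex" where
  "fourier x = coord (x (basis 0))"

definition CF :: "'g::group_add op set" where
  "CF = {x \<in> Cr. (\<lambda>g. cscale_op (fourier x g) (lreg g)) summable_on UNIV}"

section \<open>The automorphism group and its generator\<close>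

definition star_automorphism_Cr :: "('g::group_add op \<Rightarrow> 'g op) \<Rightarrow> bool" where
  "star_automorphism_Cr \<phi> \<longleftrightarrow>
     bij_betw \<phi> Cr Cr \<and>
     (\<forall>x\<in>Cr. \<forall>y\<in>Cr. \<phi> (x + y) = \<phi> x + \<phi> y) \<and>
     (\<forall>c. \<forall>x\<in>Cr. \<phi> (cscale_op c x) = cscale_op c (\<phi> x)) \<and>
     (\<forall>x\<in>Cr. \<forall>y\<in>Cr. \<phi> (x o\<^sub>L y) = \<phi> x o\<^sub>L \<phi> y) \<and>
     (\<forall>x\<in>Cr. \<phi> (adj x) = adj (\<phi> x))"

text \<open>
  A *-automorphism of a C*-algebra is isometric, so it is determined on \<^const>\<open>Cr\<close> by its values
  on the operators \<open>lreg g\<close>; existence follows by conjugating with the unitary that multiplies by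
  \<open>\<lambda>h. exp (\<i> * of_real (t * b h))\<close>.
\<close>

definition M_aut :: "('g::group_add \<Rightarrow> real) \<Rightarrow> real \<Rightarrow> 'g op \<Rightarrow> 'g op" where
  "M_aut b t = (THE \<phi>. \<phi> \<in> extensional Cr \<and> star_automorphism_Cr \<phi> \<and>
     (\<forall>g. \<phi> (lreg g) = cscale_op (exp (\<i> * of_real (t * b g))) (lreg g)))"

definition gen_dom :: "('g::group_add \<Rightarrow> real) \<Rightarrow> 'g op set" where
  "gen_dom b = {x \<in> Cr. \<exists>y\<in>Cr. ((\<lambda>t. (M_aut b t x - x) /\<^sub>R t) \<longlongrightarrow> y) (at 0)}"

text \<open>Only meaningful on \<^const>\<open>gen_dom\<close>.\<close>

definition gen :: "('g::group_add \<Rightarrow> real) \<Rightarrow> 'g op \<Rightarrow> 'g op" where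
  "gen b x = Lim (at 0) (\<lambda>t. (M_aut b t x - x) /\<^sub>R t)"

section \<open>Function spaces and the wave problem\<close>

definition Fn :: "nat \<Rightarrow> ('g::group_add \<Rightarrow> real) \<Rightarrow> 'g op set" where
  "Fn n b = {x \<in> Cr. \<forall>k\<le>n.
     (\<lambda>g. cscale_op (of_real (b g ^ k) * fourier x g) (lreg g)) summable_on UNIV \<and>
     (\<lambda>g. cscale_op (of_real (inverse (b g) ^ k) * fourier x g) (lreg g))
       summable_on {g. b g \<noteq> 0}}"

text \<open>
  \<open>infsum\<close> is the limit of the net of finite partial sums if it exists, and 0 otherwise; \<open>Tb b\<close> is
  meant on \<open>Fn 1 b\<close> and \<open>Sb b\<close> on \<^const>\<open>CF\<close>, where the series converge.
\<close>

definition Tb :: "('g::group_add \<Rightarrow> real) \<Rightarrow> 'g op \<Rightarrow> 'g op" where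
  "Tb b x = (\<Sum>\<^sub>\<infinity>g\<in>{g. b g \<noteq> 0}. cscale_op (of_real (inverse (b g)) * fourier x g) (lreg g))"

definition Sb :: "('g::group_add \<Rightarrow> real) \<Rightarrow> 'g op \<Rightarrow> 'g op" where
  "Sb b x = (\<Sum>\<^sub>\<infinity>g\<in>{g. b g = 0}. cscale_op (fourier x g) (lreg g))"

definition wave_dom :: "('g::group_add \<Rightarrow> real) \<Rightarrow> 'g op set" where
  "wave_dom b = Fn 2 b"

definition wave_op :: "('g::group_add \<Rightarrow> real) \<Rightarrow> 'g op \<Rightarrow> 'g op" where
  "wave_op b = gen b \<circ> gen b"

text \<open>
  The values of \<open>u\<close> at negative times are irrelevant. Since \<^const>\<open>Cr\<close> is closed, the derivatives
  of a \<^const>\<open>Cr\<close>-valued function automatically lie in \<^const>\<open>Cr\<close>.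
\<close>

definition wave_solution ::
  "'g::group_add op set \<Rightarrow> ('g op \<Rightarrow> 'g op) \<Rightarrow> 'g op \<Rightarrow> 'g op \<Rightarrow> (real \<Rightarrow> 'g op) \<Rightarrow> bool" where
  "wave_solution D H x0 y0 u \<longleftrightarrow>
     (\<forall>t\<ge>0. u t \<in> Cr) \<and>
     u 0 = x0 \<and>
     (\<forall>t>0. u t \<in> D) \<and>
     (\<exists>u' u''.
        (\<forall>t>0. (u has_vector_derivative u' t) (at t)) \<and>
        (\<forall>t>0. (u' has_vector_derivative u'' t) (at t)) \<and>
        (\<forall>t>0. u'' t = H (u t)) \<and>
        ((\<lambda>t. norm (u' t - y0)) \<longlongrightarrow> 0) (at_right 0)) \<and>
     ((\<lambda>t. norm (u t - x0)) \<longlongrightarrow> 0) (at_right 0)"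

end

theory Submission
  imports Defs
begin

text \<open>
  On Fourier coefficients the wave equation is a family of scalar equations: \<open>M_aut b t\<close> multiplies
  the coefficient at \<open>g\<close> by \<open>cis (t * b g)\<close>, the generator multiplies it by \<open>\<i> * b g\<close>, and the
  proposed \<open>u\<close> has at \<open>g\<close> the coefficient
  \<open>cos (t * b g) * fourier x0 g + sin (t * b g) / b g * fourier y0 g\<close>, with \<open>sin (t * b g) / b g\<close>
  read as \<open>t\<close> where \<open>b g = 0\<close>. This is d'Alembert's formula for \<open>v'' = - (b g)\<^sup>2 * v\<close>. An element
  of the algebra is determined by its coefficients (\<open>Cr_eqI\<close>), so all algebraic identities between
  elements reduce to scalar ones. Three analytic points remain.

  \<^item> \<open>M_aut b t\<close> is given by a definite description. A *-automorphism prescribed on the operators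
  \<open>lreg g\<close> is unique because *-automorphisms are contractive
  (\<open>star_automorphism_contractive\<close>), and conjugation with the diagonal unitary
  \<open>phase b t\<close> is one. Hence \<open>M_aut b t\<close> is this conjugation (\<open>M_aut_eq\<close>), which is linear, isometric
  and a group in \<open>t\<close>.

  \<^item> Fourier series need not converge absolutely, only unconditionally, so they cannot be differentiated
  by dominating the terms. Instead the mean value inequality, together with isometry, bounds the
  difference quotients of a tail of the series by the norm of the same tail of the formally
  differentiated series (\<open>norm_conj_phase_diff_le\<close>). The difference quotients of the partial sums
  therefore converge uniformly in \<open>t\<close>, and the two limits can be exchanged
  (\<open>conj_phase_generator\<close>).

  \<^item> The generator lowers the index of the spaces \<open>Fn\<close> by one, and so does \<open>Tb b\<close>
  (\<open>gen_Fn\<close>, \<open>Tb_Fn\<close>). Thus \<open>x0\<close> and \<open>Tb b y0\<close> both lie in \<open>Fn 2 b\<close> and can be differentiated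
  twice along the group.
\<close>

section \<open>The reduced group C*-algebra as a closed *-algebra\<close>

lemma id_eq_lreg_zero: "id_blinfun = (lreg 0 :: 'g::group_add op)"
  by (rule blinfun_eqI, rule ell2_eqI) (simp add: lreg_apply ltrans.rep_eq)

lemma lreg_compose: "lreg g o\<^sub>L lreg h = lreg (g + h)"
  by (rule blinfun_eqI, rule ell2_eqI)
    (simp add: lreg_apply ltrans.rep_eq minus_add add.assoc del: add_uminus_conv_diff)

lemma norm_cscale_op: "norm (cscale_op c T) = cmod c * norm T"
proof (rule antisym)
  have le: "norm (cscale_op c T) \<le> cmod c * norm T" for c T
  proof (rule norm_blinfun_bound)
    show "norm (cscale_op c T x) \<le> cmod c * norm T * norm x" for x
      using mult_left_mono[OF norm_blinfun[of T x], of "cmod c"]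
      by (simp add: cscale_op_apply norm_cscale mult.assoc)
  qed simp
  show "norm (cscale_op c T) \<le> cmod c * norm T"
    by (rule le)
  show "cmod c * norm T \<le> norm (cscale_op c T)"
  proof (cases "c = 0")
    case False
    have "norm T = norm (cscale_op (inverse c) (cscale_op c T))"
      using False by simp
    also have "\<dots> \<le> inverse (cmod c) * norm (cscale_op c T)"
      using le[of "inverse c" "cscale_op c T"] by (simp add: norm_inverse)
    finally show ?thesis
      using False by (simp add: field_simps)
  qed simp
qed

lemma scaleR_eq_cscale_op: "r *\<^sub>R T = cscale_op (of_real r) T"
  by (rule blinfun_eqI) (simp add: cscale_op_apply blinfun.scaleR_left scaleR_ell2_def)

lemma cscale_op_scaleR: "cscale_op c (r *\<^sub>R T) = r *\<^sub>R cscale_op c T"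
  by (simp add: scaleR_eq_cscale_op mult.commute)

lemma cscale_op_scaleR_left: "cscale_op (r *\<^sub>R c) T = r *\<^sub>R cscale_op c T"
  by (simp add: scaleR_eq_cscale_op scaleR_conv_of_real)

lemma bounded_bilinear_cscale_op: "bounded_bilinear cscale_op"
  by (rule bounded_bilinear.intro)
    (auto simp: cop.scale_left_distrib cop.scale_right_distrib cscale_op_scaleR
      cscale_op_scaleR_left norm_cscale_op intro!: exI[of _ 1])

lemmas bounded_linear_cscale_op = bounded_bilinear.bounded_linear_right[OF bounded_bilinear_cscale_op]

lemma closed_Cr: "closed Cr"
  by (simp add: Cr_def)

lemma lreg_in_Cr: "lreg g \<in> Cr"
  unfolding Cr_def by (intro subsetD[OF closure_subset] cop.span_base rangeI)

text \<open>
  The induction principle for the algebra: a closed complex-linear condition holds on all of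
  it once it holds on the operators \<open>lreg g\<close>.
\<close>

lemma Cr_subset_closed:
  assumes "closed S" "cop.subspace S" "range lreg \<subseteq> S"
  shows "Cr \<subseteq> S"
  unfolding Cr_def using assms by (intro closure_minimal cop.span_minimal) auto

lemma subspace_Cr: "cop.subspace (Cr :: 'g::group_add op set)"
proof (rule cop.subspaceI)
  let ?S = "cop.span (range lreg) :: 'g op set"
  show "0 \<in> (Cr :: 'g op set)"
    unfolding Cr_def using closure_subset cop.span_zero by blast
  show "x + y \<in> Cr" if "x \<in> Cr" "y \<in> Cr" for x y :: "'g op"
  proof -
    from that obtain f k where "\<And>n. f n \<in> ?S" "f \<longlonglongrightarrow> x" "\<And>n. k n \<in> ?S" "k \<longlonglongrightarrow> y"
      unfolding Cr_def closure_sequential by blast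
    then show ?thesis
      unfolding Cr_def closure_sequential
      by (intro exI[of _ "\<lambda>n. f n + k n"]) (auto intro: cop.span_add tendsto_add)
  qed
  show "cscale_op c x \<in> Cr" if "x \<in> Cr" for x :: "'g op" and c
  proof -
    from that obtain f where "\<And>n. f n \<in> ?S" "f \<longlonglongrightarrow> x"
      unfolding Cr_def closure_sequential by blast
    then show ?thesis
      unfolding Cr_def closure_sequential
      by (intro exI[of _ "\<lambda>n. cscale_op c (f n)"])
        (auto intro: cop.span_scale bounded_linear.tendsto[OF bounded_linear_cscale_op])
  qed
qed

lemmas Cr_zero = cop.subspace_0[OF subspace_Cr]
  and Cr_add = cop.subspace_add[OF subspace_Cr]
  and Cr_diff = cop.subspace_diff[OF subspace_Cr]
  and Cr_cscale = cop.subspace_scale[OF subspace_Cr]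
  and Cr_sum = cop.subspace_sum[OF subspace_Cr]

lemma Cr_scaleR: "x \<in> Cr \<Longrightarrow> r *\<^sub>R x \<in> Cr"
  by (simp add: scaleR_eq_cscale_op Cr_cscale)

lemma cscale_op_compose_left: "cscale_op c T o\<^sub>L U = cscale_op c (T o\<^sub>L U)"
  by (rule blinfun_eqI) (simp add: cscale_op_apply)

text \<open>
  Operators here need only be real-linear, so a scalar may be moved past the left factor of a
  product only if this factor is known to be complex-linear.
\<close>

lemma lreg_compose_cscale_op: "lreg g o\<^sub>L cscale_op c T = cscale_op c (lreg g o\<^sub>L T)"
  by (rule blinfun_eqI, rule ell2_eqI)
    (simp add: cscale_op_apply lreg_apply ltrans.rep_eq coord_cscale)

lemma bounded_linear_compose_left: "bounded_linear (\<lambda>T. T o\<^sub>L U)"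
  and bounded_linear_compose_right: "bounded_linear (\<lambda>T. U o\<^sub>L T)"
  by (intro bounded_bilinear.bounded_linear_left[OF bounded_bilinear_blinfun_compose]
      bounded_bilinear.bounded_linear_right[OF bounded_bilinear_blinfun_compose])+

lemmas compose_add_left = bounded_bilinear.add_left[OF bounded_bilinear_blinfun_compose]
  and compose_add_right = bounded_bilinear.add_right[OF bounded_bilinear_blinfun_compose]
  and compose_zero_left = bounded_bilinear.zero_left[OF bounded_bilinear_blinfun_compose]
  and compose_zero_right = bounded_bilinear.zero_right[OF bounded_bilinear_blinfun_compose]
  and compose_diff_left = bounded_bilinear.diff_left[OF bounded_bilinear_blinfun_compose]
  and compose_diff_right = bounded_bilinear.diff_right[OF bounded_bilinear_blinfun_compose]
  and compose_scaleR_left = bounded_bilinear.scaleR_left[OF bounded_bilinear_blinfun_compose]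
  and compose_scaleR_right = bounded_bilinear.scaleR_right[OF bounded_bilinear_blinfun_compose]

text \<open>
  Multiplication is only bilinear, so the density argument runs twice: first in the right factor
  with the left one equal to some \<open>lreg g\<close>, then in the left factor.
\<close>

lemma Cr_compose:
  fixes x y :: "'g::group_add op"
  assumes "x \<in> Cr" "y \<in> Cr"
  shows "x o\<^sub>L y \<in> Cr"
proof -
  have l: "Cr \<subseteq> {y. lreg g o\<^sub>L y \<in> Cr}" for g :: 'g
  proof (rule Cr_subset_closed)
    show "closed {y. lreg g o\<^sub>L y \<in> Cr}"
      using continuous_closed_vimage[OF closed_Cr, of "\<lambda>y. lreg g o\<^sub>L y"]
      by (simp add: vimage_def linear_continuous_at bounded_linear_compose_right)
    show "cop.subspace {y. lreg g o\<^sub>L y \<in> Cr}"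
      by (rule cop.subspaceI)
        (auto simp: lreg_compose_cscale_op Cr_zero Cr_cscale Cr_add
          compose_add_right compose_zero_right)
  qed (auto simp: lreg_compose lreg_in_Cr)
  have "Cr \<subseteq> {x. x o\<^sub>L y \<in> Cr}"
  proof (rule Cr_subset_closed)
    show "closed {x. x o\<^sub>L y \<in> Cr}"
      using continuous_closed_vimage[OF closed_Cr, of "\<lambda>x. x o\<^sub>L y"]
      by (simp add: vimage_def linear_continuous_at bounded_linear_compose_left)
    show "cop.subspace {x. x o\<^sub>L y \<in> Cr}"
      by (rule cop.subspaceI)
        (auto simp: cscale_op_compose_left Cr_zero Cr_cscale Cr_add
          compose_add_left compose_zero_left)
    show "range lreg \<subseteq> {x. x o\<^sub>L y \<in> Cr}"
      using l assms by blast
  qed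
  then show ?thesis
    using assms by blast
qed

lemma cinner_commute: "cinner y x = cnj (cinner x y)"
  by (transfer, subst infsum_cnj[symmetric]) (simp add: mult.commute)

lemma cinner_zero [simp]: "cinner 0 y = 0" "cinner x 0 = 0"
  by (transfer, simp)+

lemma cinner_cscale_left: "cinner (cscale c x) y = c * cinner x y"
  by transfer (simp add: mult.assoc infsum_cmult_right')

text \<open>
  Expresses the complex inner product by the real one, whose continuity is already available.
\<close>

lemma cinner_eq_Complex_inner: "cinner x y = Complex (x \<bullet> y) (cscale (- \<i>) x \<bullet> y)"
  by (simp add: inner_ell2_def complex_eq_iff cinner_cscale_left)

lemma cinner_add_left: "cinner (x + y) z = cinner x z + cinner y z"
  by transfer (simp add: distrib_right infsum_add ell2_mult_summable)

lemma cinner_add_right: "cinner x (y + z) = cinner x y + cinner x z"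
  using cinner_commute[of x] cinner_add_left[of y z x] by simp

lemma cinner_cscale_right: "cinner x (cscale c y) = cnj c * cinner x y"
  using cinner_commute[of x] cinner_cscale_left[of c y x] by simp

lemma tendsto_cinner:
  assumes "(f \<longlongrightarrow> x) F" "(k \<longlongrightarrow> y) F"
  shows "((\<lambda>n. cinner (f n) (k n)) \<longlongrightarrow> cinner x y) F"
  unfolding cinner_eq_Complex_inner
  by (intro tendsto_Complex tendsto_inner assms bounded_linear.tendsto[OF bounded_linear_cscale])

lemma cinner_basis: "cinner x (basis h) = coord x h"
proof -
  have "((\<lambda>k. coord x k * cnj (coord (basis h) k)) has_sum coord x h) {h}"
    by (simp add: has_sum_finite_iff basis.rep_eq)
  also have "?this \<longleftrightarrow> ((\<lambda>k. coord x k * cnj (coord (basis h) k)) has_sum coord x h) UNIV"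
    by (rule has_sum_cong_neutral) (auto simp: basis.rep_eq)
  finally show ?thesis
    using has_sum_cinner has_sum_unique by blast
qed

text \<open>
  \<^const>\<open>adj\<close> is a definite description, defined by this relation. The relation can be manipulated
  before the existence of an adjoint is known.
\<close>

definition is_adj :: "'g op \<Rightarrow> 'g op \<Rightarrow> bool" where
  "is_adj T S \<longleftrightarrow> (\<forall>x y. cinner (T x) y = cinner x (S y))"

lemma is_adj_inner: "is_adj T S \<Longrightarrow> T x \<bullet> y = x \<bullet> S y"
  by (simp add: is_adj_def inner_ell2_def)

lemma is_adj_unique:
  assumes "is_adj T S" "is_adj T S'"
  shows "S = S'"
proof (rule blinfun_eqI)
  fix y
  have "x \<bullet> S y = x \<bullet> S' y" for x
    unfolding is_adj_inner[OF assms(1), symmetric] is_adj_inner[OF assms(2), symmetric] ..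
  then show "S y = S' y"
    by (rule vector_eq_ldot[THEN iffD1, OF allI])
qed

lemma is_adj_sym: "is_adj T S \<Longrightarrow> is_adj S T"
  unfolding is_adj_def by (metis cinner_commute)

lemma adj_eqI: "is_adj T S \<Longrightarrow> adj T = S"
  unfolding adj_def
  by (rule the_equality) (auto simp: is_adj_def[symmetric] intro: is_adj_unique)

lemma is_adj_norm_le:
  assumes "is_adj T S"
  shows "norm S \<le> norm T"
proof (rule norm_blinfun_bound)
  fix y
  have "norm (S y) * norm (S y) = T (S y) \<bullet> y"
    by (simp add: is_adj_inner[OF assms] dot_square_norm power2_eq_square)
  also have "\<dots> \<le> norm (T (S y)) * norm y"
    by (rule norm_cauchy_schwarz)
  also have "\<dots> \<le> (norm T * norm (S y)) * norm y"
    by (intro mult_right_mono norm_blinfun) simp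
  finally show "norm (S y) \<le> norm T * norm y"
    by (cases "norm (S y) = 0") (simp_all add: mult_ac)
qed simp

lemma is_adj_zero: "is_adj 0 0"
  by (simp add: is_adj_def)

lemma is_adj_add: "is_adj T S \<Longrightarrow> is_adj T' S' \<Longrightarrow> is_adj (T + T') (S + S')"
  by (simp add: is_adj_def blinfun.add_left cinner_add_left cinner_add_right)

lemma is_adj_cscale: "is_adj T S \<Longrightarrow> is_adj (cscale_op c T) (cscale_op (cnj c) S)"
  by (simp add: is_adj_def cscale_op_apply cinner_cscale_left cinner_cscale_right)

lemma is_adj_diff: "is_adj T S \<Longrightarrow> is_adj T' S' \<Longrightarrow> is_adj (T - T') (S - S')"
  using is_adj_add[of T S "cscale_op (-1) T'" "cscale_op (-1) S'"] is_adj_cscale[of T' S' "-1"]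
  by simp

lemma is_adj_compose: "is_adj T S \<Longrightarrow> is_adj T' S' \<Longrightarrow> is_adj (T o\<^sub>L T') (S' o\<^sub>L S)"
  by (simp add: is_adj_def)

lemma is_adj_lreg: "is_adj (lreg g) (lreg (- g))"
proof -
  have "cinner (ltrans g x) y = cinner x (ltrans (- g) y)" for x y
  proof -
    have "cinner (ltrans g x) y = (\<Sum>\<^sub>\<infinity>h. coord x (- g + h) * cnj (coord y h))"
      by transfer simp
    also have "\<dots> = (\<Sum>\<^sub>\<infinity>h. coord x (- g + h) * cnj (coord y (g + (- g + h))))"
      by (simp only: add_minus_cancel)
    also have "\<dots> = (\<Sum>\<^sub>\<infinity>h. coord x h * cnj (coord y (g + h)))"
      by (rule infsum_reindex_bij_betw[OF bij_left_translation])
    also have "\<dots> = cinner x (ltrans (- g) y)"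
      by transfer simp
    finally show ?thesis .
  qed
  then show ?thesis
    by (simp add: is_adj_def lreg_apply)
qed

lemma is_adj_limit:
  assumes "\<And>n. is_adj (T n) (S n)" "T \<longlonglongrightarrow> T'" "S \<longlonglongrightarrow> S'"
  shows "is_adj T' S'"
  unfolding is_adj_def
proof (intro allI)
  fix x y
  have "(\<lambda>n. cinner (T n x) y) \<longlonglongrightarrow> cinner (T' x) y"
    by (intro tendsto_cinner tendsto_const bounded_linear.tendsto[OF blinfun.bounded_linear_left] assms)
  moreover have "(\<lambda>n. cinner x (S n y)) \<longlonglongrightarrow> cinner x (S' y)"
    by (intro tendsto_cinner tendsto_const bounded_linear.tendsto[OF blinfun.bounded_linear_left] assms)
  ultimately show "cinner (T' x) y = cinner x (S' y)"
    using assms(1) LIMSEQ_unique by (force simp: is_adj_def)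
qed

text \<open>
  Adjoints exist for \<open>lreg g\<close>, hence for its linear combinations, and \<open>is_adj_norm_le\<close> makes the
  adjoints of a convergent sequence a Cauchy sequence. This avoids the Riesz representation
  theorem and shows at the same time that the adjoint stays in the algebra.
\<close>

lemma Cr_is_adj:
  fixes x :: "'g::group_add op"
  assumes "x \<in> Cr"
  shows "adj x \<in> Cr" "is_adj x (adj x)"
proof -
  let ?S = "{T. \<exists>S\<in>Cr. is_adj T S} :: 'g op set"
  have "Cr \<subseteq> ?S"
  proof (rule Cr_subset_closed)
    show "closed ?S"
      unfolding closed_sequential_limits
    proof (intro allI impI)
      fix T l assume "(\<forall>n. T n \<in> ?S) \<and> T \<longlonglongrightarrow> l"
      then have lim: "T \<longlonglongrightarrow> l" and "\<forall>n. \<exists>S\<in>Cr. is_adj (T n) S"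
        by auto
      then obtain S where S: "\<And>n. S n \<in> Cr" "\<And>n. is_adj (T n) (S n)"
        by metis
      have "Cauchy S"
      proof (rule metric_CauchyI)
        fix e :: real assume "0 < e"
        then obtain M where "\<And>m n. m \<ge> M \<Longrightarrow> n \<ge> M \<Longrightarrow> dist (T m) (T n) < e"
          using metric_CauchyD[OF LIMSEQ_imp_Cauchy[OF lim]] by blast
        moreover have "dist (S m) (S n) \<le> dist (T m) (T n)" for m n
          unfolding dist_norm by (intro is_adj_norm_le is_adj_diff S)
        ultimately show "\<exists>M. \<forall>m\<ge>M. \<forall>n\<ge>M. dist (S m) (S n) < e"
          by (meson order_le_less_trans)
      qed
      then obtain S' where "S \<longlonglongrightarrow> S'"
        using Cauchy_convergent convergent_def by blast
      moreover from this have "S' \<in> Cr"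
        by (rule closed_sequentially[OF closed_Cr S(1)])
      ultimately show "l \<in> ?S"
        using is_adj_limit[OF S(2) lim] by blast
    qed
    show "cop.subspace ?S"
      by (rule cop.subspaceI)
        (blast intro: Cr_zero is_adj_zero Cr_add is_adj_add Cr_cscale is_adj_cscale)+
    show "range lreg \<subseteq> ?S"
      using is_adj_lreg lreg_in_Cr by blast
  qed
  then obtain S where "S \<in> Cr" "is_adj x S"
    using assms by blast
  then show "adj x \<in> Cr" "is_adj x (adj x)"
    using adj_eqI by auto
qed

section \<open>Rigidity of *-automorphisms\<close>

lemma Cr_one: "id_blinfun \<in> (Cr :: 'g::group_add op set)"
  by (simp add: id_eq_lreg_zero lreg_in_Cr)

lemma compose_id [simp]: "T o\<^sub>L id_blinfun = T" "id_blinfun o\<^sub>L T = T"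
  by (auto intro: blinfun_eqI)

lemma blinfun_compose_assoc: "(T o\<^sub>L U) o\<^sub>L V = T o\<^sub>L (U o\<^sub>L V)"
  by (rule blinfun_eqI) simp

text \<open>
  Neumann series: \<open>(\<Sum>n. y\<^sup>n / N\<^sup>n\<^sup>+\<^sup>1)\<close> is an inverse, and its partial sums lie in the closed set
  \<^const>\<open>Cr\<close>. Membership of the inverse in \<^const>\<open>Cr\<close> matters, since an automorphism can only be
  applied there.
\<close>

lemma Cr_left_inverse:
  fixes y :: "'g::group_add op"
  assumes y: "y \<in> Cr" and N: "norm y < N"
  obtains z where "z \<in> Cr" "z o\<^sub>L (N *\<^sub>R id_blinfun - y) = id_blinfun"
proof -
  have Npos: "N > 0"
    using N norm_ge_zero order_le_less_trans by blast
  define w where "w = y /\<^sub>R N"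
  define p where "p n = ((\<lambda>v. v o\<^sub>L w) ^^ n) id_blinfun" for n :: nat
  have p_Suc: "p (Suc n) = p n o\<^sub>L w" for n
    by (simp add: p_def)
  have "norm w < 1"
    using N Npos by (simp add: w_def field_simps)
  have p_norm: "norm (p n) \<le> norm w ^ n" for n
  proof (induction n)
    case 0
    then show ?case
      by (simp add: p_def norm_blinfun_id_le)
  next
    case (Suc n)
    have "norm (p (Suc n)) \<le> norm (p n) * norm w"
      unfolding p_Suc by (rule norm_blinfun_compose)
    also have "\<dots> \<le> norm w ^ n * norm w"
      by (intro mult_right_mono Suc) simp
    finally show ?case
      by (simp add: mult.commute)
  qed
  have "w \<in> Cr"
    by (simp add: w_def y Cr_scaleR)
  have p_Cr: "p n \<in> Cr" for n
    by (induction n) (simp_all add: p_Suc Cr_compose \<open>w \<in> Cr\<close>, simp add: p_def Cr_one)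
  have "summable p"
    by (rule summable_comparison_test'[OF summable_geometric[of "norm w"]])
      (use \<open>norm w < 1\<close> p_norm in auto)
  then obtain s where s: "(\<lambda>n. \<Sum>k<n. p k) \<longlonglongrightarrow> s"
    unfolding summable_def sums_def by blast
  have "s \<in> Cr"
    by (rule closed_sequentially[OF closed_Cr _ s]) (intro Cr_sum p_Cr)
  have "(\<Sum>k<n. p k) o\<^sub>L (id_blinfun - w) = id_blinfun - p n" for n
  proof (induction n)
    case 0
    then show ?case
      by (simp add: p_def)
  next
    case (Suc n)
    have "(\<Sum>k<Suc n. p k) o\<^sub>L (id_blinfun - w)
        = ((\<Sum>k<n. p k) o\<^sub>L (id_blinfun - w)) + (p n - p (Suc n))"
      by (simp add: p_Suc compose_diff_left compose_diff_right compose_add_left)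
    then show ?case
      by (simp only: Suc.IH) simp
  qed
  moreover have "(\<lambda>n. (\<Sum>k<n. p k) o\<^sub>L (id_blinfun - w)) \<longlonglongrightarrow> (s o\<^sub>L (id_blinfun - w))"
    by (rule bounded_linear.tendsto[OF bounded_linear_compose_left s])
  moreover have "(\<lambda>n. id_blinfun - p n) \<longlonglongrightarrow> id_blinfun - 0"
    by (intro tendsto_intros summable_LIMSEQ_zero \<open>summable p\<close>)
  ultimately have inv: "s o\<^sub>L (id_blinfun - w) = id_blinfun"
    using LIMSEQ_unique by fastforce
  have "N *\<^sub>R id_blinfun - y = N *\<^sub>R (id_blinfun - w)"
    using Npos by (simp add: w_def scaleR_right_diff_distrib)
  then have "(s /\<^sub>R N) o\<^sub>L (N *\<^sub>R id_blinfun - y) = id_blinfun"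
    using Npos inv by (simp add: compose_scaleR_left compose_scaleR_right)
  with that \<open>s \<in> Cr\<close> show thesis
    using Cr_scaleR by blast
qed

text \<open>
  For a positive operator \<open>Y X\<close>, with \<open>Y\<close> the adjoint of \<open>X\<close>, the norm \<open>N = (norm X)\<^sup>2\<close> is an
  approximate eigenvalue: if \<open>X v\<close> nearly attains \<open>norm X\<close> on a unit vector \<open>v\<close>, then \<open>Y (X v)\<close> is
  close to \<open>N v\<close>. A left inverse of \<open>N - Y X\<close> would bound it below and so keep \<open>norm (X v)\<close> away from
  \<open>norm X\<close>.
\<close>

lemma norm_no_left_inverse:
  assumes adj: "is_adj X Y" and "X \<noteq> 0"
  shows "z o\<^sub>L ((norm X)\<^sup>2 *\<^sub>R id_blinfun - (Y o\<^sub>L X)) \<noteq> id_blinfun"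
proof
  define N where "N = (norm X)\<^sup>2"
  have "N > 0"
    using \<open>X \<noteq> 0\<close> by (simp add: N_def)
  assume z: "z o\<^sub>L ((norm X)\<^sup>2 *\<^sub>R id_blinfun - (Y o\<^sub>L X)) = id_blinfun"
  define K where "K = norm z"
  have "K > 0"
  proof (rule ccontr)
    assume "\<not> K > 0"
    then have "z = 0"
      by (simp add: K_def)
    with z have "id_blinfun = (0 :: 'a op)"
      by simp
    then have "v = 0" for v :: "'a ell2"
      using fun_cong[OF blinfun_apply_id_blinfun, of v] by (simp del: blinfun_apply_id_blinfun)
    then have "X = 0"
      by (intro blinfun_eqI) metis
    with \<open>X \<noteq> 0\<close> show False ..
  qed
  \<comment> \<open>The constant results from expanding \<open>(norm (N *\<^sub>R v - Y (X v)))\<^sup>2\<close>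
    and estimating \<open>(norm (Y (X v)))\<^sup>2\<close> by \<open>N\<^sup>2 * (norm v)\<^sup>2\<close>.\<close>
  have bound: "(norm (X v))\<^sup>2 \<le> (N - 1 / (2 * N * K\<^sup>2)) * (norm v)\<^sup>2" for v
  proof -
    have YX: "Y (X v) \<bullet> v = (norm (X v))\<^sup>2"
      using is_adj_inner[OF adj, of v "X v"] by (simp add: inner_commute power2_norm_eq_inner)
    have "norm (Y (X v)) \<le> N * norm v"
    proof -
      have "norm (Y (X v)) \<le> norm Y * norm (X v)"
        by (rule norm_blinfun)
      also have "\<dots> \<le> norm X * (norm X * norm v)"
        by (intro mult_mono norm_blinfun is_adj_norm_le adj) auto
      finally show ?thesis
        by (simp add: N_def power2_eq_square mult.assoc)
    qed
    then have Tv: "(norm (Y (X v)))\<^sup>2 \<le> N\<^sup>2 * (norm v)\<^sup>2"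
      unfolding power_mult_distrib[symmetric] by (intro power_mono) auto
    have "v = z (N *\<^sub>R v - Y (X v))"
      using arg_cong[OF z, of "\<lambda>T. T v"]
      by (simp add: N_def blinfun.diff_left blinfun.scaleR_left)
    then have "norm v \<le> K * norm (N *\<^sub>R v - Y (X v))"
      unfolding K_def by (metis norm_blinfun)
    then have "(norm v)\<^sup>2 \<le> K\<^sup>2 * (norm (N *\<^sub>R v - Y (X v)))\<^sup>2"
      unfolding power_mult_distrib[symmetric] by (intro power_mono) auto
    also have "(norm (N *\<^sub>R v - Y (X v)))\<^sup>2
        = N\<^sup>2 * (norm v)\<^sup>2 - 2 * N * (norm (X v))\<^sup>2 + (norm (Y (X v)))\<^sup>2"
      using YX unfolding power2_norm_eq_inner
      by (simp add: inner_diff_left inner_diff_right inner_commute power2_eq_square)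
    also have "K\<^sup>2 * \<dots> \<le> K\<^sup>2 * (2 * N\<^sup>2 * (norm v)\<^sup>2 - 2 * N * (norm (X v))\<^sup>2)"
      by (intro mult_left_mono) (use Tv in auto)
    finally show ?thesis
      using \<open>K > 0\<close> \<open>N > 0\<close> by (simp add: field_simps power2_eq_square)
  qed
  have le: "(norm X)\<^sup>2 \<le> N - 1 / (2 * N * K\<^sup>2)"
  proof -
    obtain v where "X v \<noteq> 0"
      using \<open>X \<noteq> 0\<close> by (metis blinfun_eqI zero_blinfun.rep_eq)
    then have "0 < (norm (X v))\<^sup>2" "v \<noteq> 0"
      by auto
    with bound[of v] have "0 < (N - 1 / (2 * N * K\<^sup>2)) * (norm v)\<^sup>2"
      by linarith
    then have pos: "0 < N - 1 / (2 * N * K\<^sup>2)"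
      using \<open>v \<noteq> 0\<close> by (simp add: zero_less_mult_iff)
    have "norm (X v) \<le> sqrt (N - 1 / (2 * N * K\<^sup>2)) * norm v" for v
      using real_sqrt_le_mono[OF bound[of v]] by (simp add: real_sqrt_mult)
    then have "norm X \<le> sqrt (N - 1 / (2 * N * K\<^sup>2))"
      using pos by (intro norm_blinfun_bound) auto
    then have "(norm X)\<^sup>2 \<le> (sqrt (N - 1 / (2 * N * K\<^sup>2)))\<^sup>2"
      by (intro power_mono) auto
    then show ?thesis
      using pos by simp
  qed
  have "0 < 1 / (2 * N * K\<^sup>2)"
    using \<open>K > 0\<close> \<open>N > 0\<close> by simp
  with le show False
    unfolding N_def[symmetric] by linarith
qed

text \<open>
  If \<open>norm (\<phi> x)\<close> exceeded \<open>norm x\<close>, then \<open>N = (norm (\<phi> x))\<^sup>2\<close> would be larger than the norm of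
  \<open>y = adj x o\<^sub>L x\<close>, so \<open>N - y\<close> would have a left inverse in the algebra. Its image under \<open>\<phi>\<close> would be
  a left inverse of \<open>N - adj (\<phi> x) o\<^sub>L \<phi> x\<close>, which \<open>norm_no_left_inverse\<close> excludes.
\<close>

lemma star_automorphism_contractive:
  fixes \<phi> :: "'g::group_add op \<Rightarrow> 'g op"
  assumes \<phi>: "star_automorphism_Cr \<phi>" and x: "x \<in> Cr"
  shows "norm (\<phi> x) \<le> norm x"
proof (rule ccontr)
  assume "\<not> norm (\<phi> x) \<le> norm x"
  then have less: "norm x < norm (\<phi> x)"
    by simp
  have in_Cr: "\<phi> y \<in> Cr" if "y \<in> Cr" for y
    using \<phi> that by (auto simp: star_automorphism_Cr_def bij_betw_def)
  have add: "\<phi> (y + z) = \<phi> y + \<phi> z" if "y \<in> Cr" "z \<in> Cr" for y z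
    using \<phi> that by (simp add: star_automorphism_Cr_def)
  have scale: "\<phi> (cscale_op c y) = cscale_op c (\<phi> y)" if "y \<in> Cr" for c y
    using \<phi> that by (simp add: star_automorphism_Cr_def)
  have comp: "\<phi> (y o\<^sub>L z) = \<phi> y o\<^sub>L \<phi> z" if "y \<in> Cr" "z \<in> Cr" for y z
    using \<phi> that by (simp add: star_automorphism_Cr_def)
  have adj: "\<phi> (adj y) = adj (\<phi> y)" if "y \<in> Cr" for y
    using \<phi> that by (simp add: star_automorphism_Cr_def)
  \<comment> \<open>\<open>\<phi> id_blinfun\<close> is a unit for the range of \<open>\<phi>\<close>, which contains the identity.\<close>
  have one: "\<phi> id_blinfun = id_blinfun"
  proof -
    obtain e where e: "e \<in> Cr" "\<phi> e = id_blinfun"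
      using \<phi> Cr_one unfolding star_automorphism_Cr_def bij_betw_def by (metis imageE)
    have "\<phi> id_blinfun = \<phi> e o\<^sub>L \<phi> id_blinfun"
      by (simp add: e)
    also have "\<dots> = \<phi> (e o\<^sub>L id_blinfun)"
      by (simp only: comp e Cr_one)
    finally show ?thesis
      by (simp add: e)
  qed
  define N where "N = (norm (\<phi> x))\<^sup>2"
  define y where "y = adj x o\<^sub>L x"
  have y: "y \<in> Cr"
    by (simp add: y_def Cr_compose Cr_is_adj x)
  have "norm y \<le> norm (adj x) * norm x"
    unfolding y_def by (rule norm_blinfun_compose)
  also have "\<dots> \<le> norm x * norm x"
    by (intro mult_right_mono is_adj_norm_le Cr_is_adj x) simp
  also have "\<dots> < N"
    unfolding N_def power2_eq_square using less by (intro mult_strict_mono') auto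
  finally obtain z where z: "z \<in> Cr" "z o\<^sub>L (N *\<^sub>R id_blinfun - y) = id_blinfun"
    using Cr_left_inverse[OF y] by blast
  have "\<phi> (N *\<^sub>R id_blinfun - y) = \<phi> (cscale_op (of_real N) id_blinfun + cscale_op (- 1) y)"
    by (simp add: scaleR_eq_cscale_op)
  also have "\<dots> = cscale_op (of_real N) (\<phi> id_blinfun) + cscale_op (- 1) (\<phi> y)"
    by (simp only: add scale Cr_cscale Cr_one y)
  also have "\<dots> = N *\<^sub>R id_blinfun - (adj (\<phi> x) o\<^sub>L \<phi> x)"
    by (simp add: one scaleR_eq_cscale_op y_def comp Cr_is_adj x adj)
  finally have "\<phi> z o\<^sub>L (N *\<^sub>R id_blinfun - (adj (\<phi> x) o\<^sub>L \<phi> x)) = id_blinfun"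
    using comp[OF z(1), of "N *\<^sub>R id_blinfun - y"] z(2) one
    by (simp add: Cr_diff Cr_scaleR Cr_one y)
  moreover have "\<phi> x \<noteq> 0"
    using less norm_ge_zero[of x] by fastforce
  ultimately show False
    using norm_no_left_inverse[OF Cr_is_adj(2)[OF in_Cr[OF x]]] by (simp add: N_def)
qed

text \<open>
  Contractivity makes both maps continuous, so the set on which they agree is closed.
\<close>

lemma star_automorphism_eqI:
  fixes \<phi> \<psi> :: "'g::group_add op \<Rightarrow> 'g op"
  assumes \<phi>: "star_automorphism_Cr \<phi>" and \<psi>: "star_automorphism_Cr \<psi>"
    and eq: "\<And>g. \<phi> (lreg g) = \<psi> (lreg g)" and x: "x \<in> Cr"
  shows "\<phi> x = \<psi> x"
proof -
  let ?S = "{x \<in> Cr. \<phi> x = \<psi> x}"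
  have diff: "\<theta> (y - z) = \<theta> y - \<theta> z"
    if \<theta>: "star_automorphism_Cr \<theta>" and "y \<in> Cr" "z \<in> Cr" for \<theta> y z
  proof -
    have "\<theta> (y + cscale_op (-1) z) = \<theta> y + cscale_op (-1) (\<theta> z)"
      using that Cr_cscale unfolding star_automorphism_Cr_def by metis
    then show ?thesis
      by simp
  qed
  have "Cr \<subseteq> ?S"
  proof (rule Cr_subset_closed)
    show "closed ?S"
      unfolding closed_sequential_limits
    proof (intro allI impI)
      fix s l assume "(\<forall>n. s n \<in> ?S) \<and> s \<longlonglongrightarrow> l"
      then have s: "\<And>n. s n \<in> Cr" "\<And>n. \<phi> (s n) = \<psi> (s n)" and lim: "s \<longlonglongrightarrow> l"
        by auto
      have l: "l \<in> Cr"
        by (rule closed_sequentially[OF closed_Cr s(1) lim])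
      have conv: "(\<lambda>n. \<theta> (s n)) \<longlonglongrightarrow> \<theta> l" if \<theta>: "star_automorphism_Cr \<theta>" for \<theta>
      proof (rule metric_tendsto_imp_tendsto[OF lim])
        show "\<forall>\<^sub>F n in sequentially. dist (\<theta> (s n)) (\<theta> l) \<le> dist (s n) l"
          using star_automorphism_contractive[OF \<theta>] diff[OF \<theta>]
          by (metis (mono_tags, lifting) Cr_diff dist_norm eventuallyI l s(1))
      qed
      show "l \<in> ?S"
        using conv[OF \<phi>] conv[OF \<psi>] l LIMSEQ_unique by (auto simp: s(2))
    qed
    show "cop.subspace ?S"
    proof (rule cop.subspaceI)
      show "0 \<in> ?S"
        using diff[OF \<phi>, of 0 0] diff[OF \<psi>, of 0 0] by (simp add: Cr_zero)
    qed (use \<phi> \<psi> in \<open>auto simp: star_automorphism_Cr_def Cr_add Cr_cscale\<close>)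
    show "range lreg \<subseteq> ?S"
      using eq lreg_in_Cr by auto
  qed
  then show ?thesis
    using x by blast
qed

section \<open>The automorphism group as conjugation by phases\<close>

lemma phase_summable:
  assumes "(\<lambda>h. (cmod (f h))\<^sup>2) summable_on UNIV"
  shows "(\<lambda>h. (cmod (cis (t * b h) * f h))\<^sup>2) summable_on UNIV"
  using assms by (simp add: norm_mult)

lift_definition phase_ell2 :: "('g \<Rightarrow> real) \<Rightarrow> real \<Rightarrow> 'g ell2 \<Rightarrow> 'g ell2"
  is "\<lambda>b t f h. cis (t * b h) * f h"
  by (rule phase_summable)

definition phase :: "('g \<Rightarrow> real) \<Rightarrow> real \<Rightarrow> 'g op" where
  "phase b t = Blinfun (phase_ell2 b t)"

lemma norm_phase_ell2: "norm (phase_ell2 b t x) = norm x"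
  by (simp add: norm_ell2_eq phase_ell2.rep_eq norm_mult)

lemma coord_phase: "coord (phase b t x) h = cis (t * b h) * coord x h"
proof -
  have "bounded_linear (phase_ell2 b t)"
    by (rule bounded_linear_intro[where K = 1])
      (auto intro!: ell2_eqI simp: phase_ell2.rep_eq coord_plus coord_scaleR norm_phase_ell2 algebra_simps)
  then show ?thesis
    by (simp add: phase_def bounded_linear_Blinfun_apply phase_ell2.rep_eq)
qed

lemma norm_phase: "norm (phase b t x) = norm x"
  by (simp add: norm_ell2_eq coord_phase norm_mult)

lemma phase_phase: "phase b s (phase b t x) = phase b (s + t) x"
  by (rule ell2_eqI) (simp add: coord_phase cis_mult algebra_simps flip: mult.assoc)

lemma phase_zero [simp]: "phase b 0 x = x"
  by (rule ell2_eqI) (simp add: coord_phase)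

lemma phase_cscale: "phase b t (cscale c x) = cscale c (phase b t x)"
  by (rule ell2_eqI) (simp add: coord_phase coord_cscale)

lemma is_adj_phase: "is_adj (phase b t) (phase b (- t))"
proof -
  have "cinner (phase b t x) y = cinner x (phase b (- t) y)" for x y
  proof -
    have "coord (phase b t x) h * cnj (coord y h) = coord x h * cnj (coord (phase b (- t) y) h)" for h
      by (simp add: coord_phase cis_cnj)
    then show ?thesis
      unfolding cinner.rep_eq by simp
  qed
  then show ?thesis
    by (simp add: is_adj_def)
qed

definition conj_phase :: "('g \<Rightarrow> real) \<Rightarrow> real \<Rightarrow> 'g op \<Rightarrow> 'g op" where
  "conj_phase b t x = phase b t o\<^sub>L x o\<^sub>L phase b (- t)"

lemma conj_phase_apply: "conj_phase b t x v = phase b t (x (phase b (- t) v))"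
  by (simp add: conj_phase_def)

lemma conj_phase_zero [simp]: "conj_phase b 0 x = x"
  by (rule blinfun_eqI) (simp add: conj_phase_apply)

lemma conj_phase_conj_phase: "conj_phase b s (conj_phase b t x) = conj_phase b (s + t) x"
  by (rule blinfun_eqI) (simp add: conj_phase_apply phase_phase add.commute)

lemma bounded_linear_conj_phase: "bounded_linear (conj_phase b t)"
  unfolding conj_phase_def
  using bounded_linear_compose[OF bounded_linear_compose_left bounded_linear_compose_right] .

lemma conj_phase_cscale_op: "conj_phase b t (cscale_op c x) = cscale_op c (conj_phase b t x)"
  by (rule blinfun_eqI) (simp add: conj_phase_apply cscale_op_apply phase_cscale)

lemma norm_conj_phase: "norm (conj_phase b t x) = norm x"
proof -
  have le: "norm (conj_phase b t x) \<le> norm x" for t x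
  proof (rule norm_blinfun_bound)
    show "norm (conj_phase b t x v) \<le> norm x * norm v" for v
      using norm_blinfun[of x "phase b (- t) v"] by (simp add: conj_phase_apply norm_phase)
  qed simp
  show ?thesis
    using le[of t x] le[of "- t" "conj_phase b t x"] by (simp add: conj_phase_conj_phase)
qed

locale real_character =
  fixes b :: "'g::group_add \<Rightarrow> real"
  assumes b_add: "b (g + h) = b g + b h"
begin

lemma b_zero [simp]: "b 0 = 0"
  using b_add[of 0 0] by simp

text \<open>
  Additivity of \<open>b\<close> enters here: translating by \<open>g\<close> shifts the phase by the constant \<open>t * b g\<close>.
\<close>

lemma conj_phase_lreg: "conj_phase b t (lreg g) = cscale_op (cis (t * b g)) (lreg g)"
proof (rule blinfun_eqI, rule ell2_eqI)
  fix v h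
  have "b h = b g + b (- g + h)"
    by (simp flip: b_add)
  then show "coord (conj_phase b t (lreg g) v) h = coord (cscale_op (cis (t * b g)) (lreg g) v) h"
    by (simp add: conj_phase_apply coord_phase cscale_op_apply coord_cscale lreg_apply ltrans.rep_eq
        cis_mult distrib_left flip: mult.assoc)
qed

lemma conj_phase_Cr:
  assumes "x \<in> Cr"
  shows "conj_phase b t x \<in> Cr"
proof -
  interpret bounded_linear "conj_phase b t"
    by (rule bounded_linear_conj_phase)
  have "Cr \<subseteq> {x. conj_phase b t x \<in> Cr}"
  proof (rule Cr_subset_closed)
    show "closed {x. conj_phase b t x \<in> Cr}"
      using continuous_closed_vimage[OF closed_Cr, of "conj_phase b t"]
      by (simp add: vimage_def linear_continuous_at bounded_linear_conj_phase)
    show "cop.subspace {x. conj_phase b t x \<in> Cr}"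
      by (rule cop.subspaceI)
        (auto simp: add zero conj_phase_cscale_op Cr_zero Cr_cscale Cr_add)
  qed (auto simp: conj_phase_lreg lreg_in_Cr Cr_cscale)
  then show ?thesis
    using assms by blast
qed

lemma star_automorphism_conj_phase: "star_automorphism_Cr (conj_phase b t)"
proof -
  interpret bounded_linear "conj_phase b t"
    by (rule bounded_linear_conj_phase)
  have "bij_betw (conj_phase b t) Cr Cr"
    by (rule bij_betwI[where g = "conj_phase b (- t)"])
      (auto simp: conj_phase_Cr conj_phase_conj_phase)
  moreover have "conj_phase b t (x o\<^sub>L y) = conj_phase b t x o\<^sub>L conj_phase b t y" for x y
    by (rule blinfun_eqI) (simp add: conj_phase_apply phase_phase)
  moreover have "conj_phase b t (adj x) = adj (conj_phase b t x)" if "x \<in> Cr" for x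
  proof -
    have "is_adj (conj_phase b t x) (phase b (- (- t)) o\<^sub>L (adj x o\<^sub>L phase b (- t)))"
      unfolding conj_phase_def by (intro is_adj_compose is_adj_phase Cr_is_adj that)
    then show ?thesis
      by (simp add: adj_eqI conj_phase_def blinfun_compose_assoc)
  qed
  ultimately show ?thesis
    by (simp add: star_automorphism_Cr_def add conj_phase_cscale_op)
qed

lemma M_aut_eq:
  assumes "x \<in> Cr"
  shows "M_aut b t x = conj_phase b t x"
proof -
  let ?P = "\<lambda>\<phi>. \<phi> \<in> extensional Cr \<and> star_automorphism_Cr \<phi> \<and>
     (\<forall>g. \<phi> (lreg g) = cscale_op (exp (\<i> * of_real (t * b g))) (lreg g))"
  let ?\<psi> = "restrict (conj_phase b t) Cr"
  have "bij_betw ?\<psi> Cr Cr \<longleftrightarrow> bij_betw (conj_phase b t) Cr Cr"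
    by (rule bij_betw_cong) simp
  then have "star_automorphism_Cr ?\<psi>"
    using star_automorphism_conj_phase[of t] 
    by (simp add: star_automorphism_Cr_def Cr_add Cr_cscale Cr_compose Cr_is_adj)
  then have \<psi>: "?P ?\<psi>"
    by (simp add: lreg_in_Cr conj_phase_lreg cis_conv_exp)
  moreover have "\<phi> = ?\<psi>" if "?P \<phi>" for \<phi>
  proof (rule extensionalityI)
    show "\<phi> y = ?\<psi> y" if "y \<in> Cr" for y
      by (rule star_automorphism_eqI[of \<phi> ?\<psi>]) (use \<open>?P \<phi>\<close> \<psi> that in auto)
  qed (use that in auto)
  ultimately have "M_aut b t = ?\<psi>"
    unfolding M_aut_def by (rule the_equality)
  then show ?thesis
    using assms by simp
qed

end

section \<open>Fourier series in the reduced group C*-algebra\<close>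

abbreviation fourier_term :: "('g::group_add \<Rightarrow> complex) \<Rightarrow> 'g \<Rightarrow> 'g op" where
  "fourier_term \<alpha> \<equiv> \<lambda>g. cscale_op (\<alpha> g) (lreg g)"

lemma fourier_zero [simp]: "fourier 0 g = 0"
  by (simp add: fourier_def zero_ell2.rep_eq)

lemma fourier_add: "fourier (x + y) g = fourier x g + fourier y g"
  by (simp add: fourier_def blinfun.add_left coord_plus)

lemma fourier_diff: "fourier (x - y) g = fourier x g - fourier y g"
  by (simp add: fourier_def blinfun.diff_left coord_minus)

lemma fourier_cscale_op: "fourier (cscale_op c x) g = c * fourier x g"
  by (simp add: fourier_def cscale_op_apply coord_cscale)

lemma fourier_scaleR: "fourier (r *\<^sub>R x) g = of_real r * fourier x g"
  by (simp add: scaleR_eq_cscale_op fourier_cscale_op)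

lemma fourier_lreg: "fourier (lreg h) g = (if g = h then 1 else 0)"
  by (simp add: fourier_def lreg_apply ltrans.rep_eq basis.rep_eq neg_eq_iff_add_eq_0[symmetric])

lemma bounded_linear_fourier: "bounded_linear (\<lambda>x. fourier x g)"
proof (rule bounded_linear_intro)
  fix x :: "'a op"
  have "norm (fourier x g) \<le> norm (x (basis 0))"
    unfolding fourier_def by (rule norm_coord_le)
  also have "\<dots> \<le> norm x * norm (basis 0 :: 'a ell2)"
    by (rule norm_blinfun)
  finally show "norm (fourier x g) \<le> norm x * norm (basis 0 :: 'a ell2)" .
qed (simp_all add: fourier_add fourier_scaleR scaleR_conv_of_real)

lemma fourier_has_sum:
  assumes "(fourier_term \<alpha> has_sum x) A"
  shows "fourier x g = (if g \<in> A then \<alpha> g else 0)"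
proof -
  have "((\<lambda>h. fourier (fourier_term \<alpha> h) g) has_sum fourier x g) A"
    by (rule has_sum_bounded_linear[OF bounded_linear_fourier assms])
  moreover have "((\<lambda>h. fourier (fourier_term \<alpha> h) g) has_sum (if g \<in> A then \<alpha> g else 0)) A"
    by (rule has_sum_finite_neutralI[of "A \<inter> {g}"]) (auto simp: fourier_cscale_op fourier_lreg)
  ultimately show ?thesis
    by (rule has_sum_unique)
qed

lemma has_sum_in_Cr:
  assumes "(fourier_term \<alpha> has_sum x) A"
  shows "x \<in> Cr"
proof (rule Lim_in_closed_set[OF closed_Cr])
  show "(sum (fourier_term \<alpha>) \<longlongrightarrow> x) (finite_subsets_at_top A)"
    using assms by (simp add: has_sum_def)
qed (simp_all add: Cr_sum Cr_cscale lreg_in_Cr)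

text \<open>
  Elements of the algebra commute with right translations, so all matrix entries are given by the
  column at the identity, that is, by the Fourier coefficients.
\<close>

lemma Cr_coord_basis:
  fixes x :: "'g::group_add op"
  assumes "x \<in> Cr"
  shows "coord (blinfun_apply x (basis h)) k = fourier x (k - h)"
proof -
  let ?f = "\<lambda>x. coord (blinfun_apply x (basis h)) k - fourier x (k - h)"
  have bl: "bounded_linear (\<lambda>x :: 'g op. coord (blinfun_apply x (basis h)) k)"
  proof (rule bounded_linear_intro)
    fix x :: "'g op"
    show "norm (coord (blinfun_apply x (basis h)) k) \<le> norm x * norm (basis h :: 'g ell2)"
      by (rule order_trans[OF norm_coord_le norm_blinfun])
  qed (simp_all add: blinfun.add_left coord_plus blinfun.scaleR_left coord_scaleR scaleR_conv_of_real)
  have "Cr \<subseteq> {x. ?f x = 0}"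
  proof (rule Cr_subset_closed)
    show "closed {x. ?f x = 0}"
      by (intro closed_Collect_eq continuous_intros linear_continuous_on bl bounded_linear_fourier)
    show "cop.subspace {x. ?f x = 0}"
      by (rule cop.subspaceI)
        (auto simp: zero_ell2.rep_eq blinfun.add_left coord_plus fourier_add
          cscale_op_apply coord_cscale fourier_cscale_op)
    have "- g + k = h \<longleftrightarrow> k - h = g" for g
      by (metis add_minus_cancel diff_add_cancel add_diff_cancel minus_add_cancel)
    then show "range lreg \<subseteq> {x. ?f x = 0}"
      by (auto simp: fourier_lreg lreg_apply ltrans.rep_eq basis.rep_eq)
  qed
  then show ?thesis
    using assms by auto
qed

text \<open>
  If all matrix entries of \<open>z\<close> vanish, then so do those of its adjoint, which therefore kills the
  basis vectors; this makes every coordinate of every \<open>z v\<close> zero. Passing to the adjoint replaces an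
  expansion of \<open>v\<close> in the basis.
\<close>

lemma Cr_eqI:
  fixes x y :: "'g::group_add op"
  assumes "x \<in> Cr" "y \<in> Cr" "\<And>g. fourier x g = fourier y g"
  shows "x = y"
proof -
  define z where "z = x - y"
  have z: "z \<in> Cr" "\<And>g. fourier z g = 0"
    using assms by (simp_all add: z_def Cr_diff fourier_diff)
  have "adj z (basis k) = 0" for k
  proof (rule ell2_eqI)
    fix h
    have "cinner (adj z (basis k)) (basis h) = cinner (basis k) (z (basis h))"
      using is_adj_sym[OF Cr_is_adj(2)[OF z(1)]] by (simp add: is_adj_def)
    also have "\<dots> = cnj (coord (z (basis h)) k)"
      by (metis cinner_basis cinner_commute)
    also have "\<dots> = 0"
      by (simp add: Cr_coord_basis z)
    finally show "coord (adj z (basis k)) h = coord 0 h"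
      by (simp add: cinner_basis zero_ell2.rep_eq)
  qed
  then have "cinner (z v) (basis k) = 0" for v k
    using Cr_is_adj(2)[OF z(1)] by (simp add: is_adj_def)
  then have "z = 0"
    by (intro blinfun_eqI ell2_eqI) (simp add: cinner_basis zero_ell2.rep_eq)
  then show ?thesis
    by (simp add: z_def)
qed

lemma Fn_Cr: "x \<in> Fn n b \<Longrightarrow> x \<in> Cr"
  and Fn_summable: "x \<in> Fn n b \<Longrightarrow> k \<le> n \<Longrightarrow>
    fourier_term (\<lambda>g. of_real (b g ^ k) * fourier x g) summable_on UNIV"
  and Fn_summable_inverse: "x \<in> Fn n b \<Longrightarrow> k \<le> n \<Longrightarrow>
    fourier_term (\<lambda>g. of_real (inverse (b g) ^ k) * fourier x g) summable_on {g. b g \<noteq> 0}"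
  by (simp_all add: Fn_def)

lemma Fn_mono: "x \<in> Fn n b \<Longrightarrow> m \<le> n \<Longrightarrow> x \<in> Fn m b"
  by (simp add: Fn_def)

text \<open>
  The series at \<open>k = 0\<close> in the definition of \<^const>\<open>Fn\<close> converges to an element with the same
  coefficients as \<open>x\<close>.
\<close>

lemma Fn_has_sum:
  assumes "x \<in> Fn n b"
  shows "(fourier_term (fourier x) has_sum x) UNIV"
proof -
  have "fourier_term (fourier x) summable_on UNIV"
    using Fn_summable[OF assms, of 0] by simp
  then obtain y where y: "(fourier_term (fourier x) has_sum y) UNIV"
    unfolding summable_on_def by blast
  then have "y = x"
    using fourier_has_sum[OF y]
    by (intro Cr_eqI has_sum_in_Cr[OF y] Fn_Cr[OF assms]) simp
  with y show ?thesis
    by simp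
qed

text \<open>
  Completeness of the operator space lets unconditional convergence pass to subsets of the index
  set, for instance to the kernel of \<open>b\<close> or to its complement.
\<close>

lemma Fn_summable_subset:
  assumes "x \<in> Fn n b" "k \<le> n"
  shows "fourier_term (\<lambda>g. of_real (b g ^ k) * fourier x g) summable_on A"
  by (rule summable_on_subset_banach[OF Fn_summable[OF assms]]) simp

lemma fourier_term_add: "fourier_term (\<lambda>g. \<alpha> g + \<beta> g) = (\<lambda>g. fourier_term \<alpha> g + fourier_term \<beta> g)"
  by (simp add: cop.scale_left_distrib)

lemma summable_on_cscale_op:
  "f summable_on A \<Longrightarrow> (\<lambda>g. cscale_op c (f g)) summable_on A"
  by (rule summable_on_bounded_linear[OF bounded_linear_cscale_op])

lemma Fn_add:
  assumes "x \<in> Fn n b" "y \<in> Fn n b"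
  shows "x + y \<in> Fn n b"
  using assms
  by (auto simp: Fn_def Cr_add fourier_add distrib_left fourier_term_add intro!: summable_on_add)

text \<open>
  A map that multiplies Fourier coefficients by constants commutes with every weight; being bounded,
  it then preserves the convergence of all weighted series at once.
\<close>

lemma Fn_image:
  assumes T: "bounded_linear T" and x: "x \<in> Fn n b" and Cr: "T x \<in> Cr"
    and eq: "\<And>g c. T (cscale_op (c * fourier x g) (lreg g)) = cscale_op (c * fourier (T x) g) (lreg g)"
  shows "T x \<in> Fn n b"
proof -
  have summable: "fourier_term (\<lambda>g. \<alpha> g * fourier (T x) g) summable_on A"
    if "fourier_term (\<lambda>g. \<alpha> g * fourier x g) summable_on A" for \<alpha> A
    using summable_on_bounded_linear[OF T that] by (simp only: eq)
  show ?thesis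
    unfolding Fn_def mem_Collect_eq
    by (intro conjI allI impI Cr summable Fn_summable[OF x] Fn_summable_inverse[OF x])
qed

lemma Fn_cscale:
  assumes "x \<in> Fn n b"
  shows "cscale_op c x \<in> Fn n b"
  using bounded_linear_cscale_op assms Cr_cscale[OF Fn_Cr[OF assms]]
  by (rule Fn_image) (simp add: fourier_cscale_op mult_ac)

lemma Fn_scaleR: "x \<in> Fn n b \<Longrightarrow> r *\<^sub>R x \<in> Fn n b"
  by (simp add: scaleR_eq_cscale_op Fn_cscale)

lemma Fn_diff: "x \<in> Fn n b \<Longrightarrow> y \<in> Fn n b \<Longrightarrow> x - y \<in> Fn n b"
  using Fn_add[of x n b "cscale_op (-1) y"] Fn_cscale[of y n b "-1"] by simp

lemma Fn_intro:
  assumes "(fourier_term \<alpha> has_sum x) UNIV"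
    and "\<And>k. k \<le> n \<Longrightarrow> fourier_term (\<lambda>g. of_real (b g ^ k) * \<alpha> g) summable_on UNIV"
    and "\<And>k. k \<le> n \<Longrightarrow> fourier_term (\<lambda>g. of_real (inverse (b g) ^ k) * \<alpha> g) summable_on {g. b g \<noteq> 0}"
  shows "x \<in> Fn n b"
proof -
  have "fourier x = \<alpha>"
    using fourier_has_sum[OF assms(1)] by auto
  then show ?thesis
    using assms by (simp add: Fn_def has_sum_in_Cr)
qed

text \<open>
  Since \<open>inverse 0 = 0\<close>, the series defining \<^const>\<open>Tb\<close> may be taken over the whole group.
\<close>

lemma Tb_has_sum:
  assumes "y \<in> Fn (Suc n) b"
  shows "(fourier_term (\<lambda>g. of_real (inverse (b g)) * fourier y g) has_sum Tb b y) UNIV"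
proof -
  have "fourier_term (\<lambda>g. of_real (inverse (b g)) * fourier y g) summable_on {g. b g \<noteq> 0}"
    using Fn_summable_inverse[OF assms, of 1] by simp
  then have "(fourier_term (\<lambda>g. of_real (inverse (b g)) * fourier y g) has_sum Tb b y) {g. b g \<noteq> 0}"
    unfolding Tb_def by (rule has_sum_infsum)
  also have "?this \<longleftrightarrow> ?thesis"
    by (rule has_sum_cong_neutral) auto
  finally show ?thesis .
qed

text \<open>
  The mirror image of differentiation: here it is the negative powers of \<open>b g\<close> that cost one
  order.
\<close>

lemma Tb_Fn:
  assumes y: "y \<in> Fn (Suc n) b"
  shows "Tb b y \<in> Fn n b"
proof (rule Fn_intro[OF Tb_has_sum[OF y]])
  fix k assume k: "k \<le> n"
  let ?a = "\<lambda>g. of_real (inverse (b g)) * fourier y g"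
  show "fourier_term (\<lambda>g. of_real (b g ^ k) * ?a g) summable_on UNIV"
  proof (cases k)
    case 0
    then show ?thesis
      using Tb_has_sum[OF y] has_sum_imp_summable by simp
  next
    case (Suc j)
    have "?thesis \<longleftrightarrow> fourier_term (\<lambda>g. of_real (b g ^ j) * fourier y g) summable_on {g. b g \<noteq> 0}"
      by (rule summable_on_cong_neutral) (auto simp: Suc field_simps)
    then show ?thesis
      using Fn_summable_subset[OF y, of j] k Suc by simp
  qed
  show "fourier_term (\<lambda>g. of_real (inverse (b g) ^ k) * ?a g) summable_on {g. b g \<noteq> 0}"
    using Fn_summable_inverse[OF y, of "Suc k"] k by (simp add: mult_ac)
qed

lemma fourier_Tb:
  assumes "y \<in> Fn (Suc n) b"
  shows "fourier (Tb b y) g = of_real (inverse (b g)) * fourier y g"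
  using fourier_has_sum[OF Tb_has_sum[OF assms]] by simp

lemma Sb_has_sum:
  assumes "y \<in> Fn n b"
  shows "(fourier_term (\<lambda>g. if b g = 0 then fourier y g else 0) has_sum Sb b y) UNIV"
proof -
  have "fourier_term (fourier y) summable_on {g. b g = 0}"
    using Fn_summable_subset[OF assms, of 0] by simp
  then have "(fourier_term (fourier y) has_sum Sb b y) {g. b g = 0}"
    unfolding Sb_def by (rule has_sum_infsum)
  also have "?this \<longleftrightarrow> ?thesis"
    by (rule has_sum_cong_neutral) auto
  finally show ?thesis .
qed

text \<open>
  The coefficients of \<open>Sb b y\<close> are supported where \<open>b\<close> vanishes, so all weights except
  \<open>b g ^ 0\<close> annihilate them, and the order of smoothness is arbitrary.
\<close>

lemma Sb_Fn:
  assumes y: "y \<in> Fn n b"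
  shows "Sb b y \<in> Fn m b"
proof (rule Fn_intro[OF Sb_has_sum[OF y]])
  fix k
  let ?a = "\<lambda>g. if b g = 0 then fourier y g else 0"
  show "fourier_term (\<lambda>g. of_real (b g ^ k) * ?a g) summable_on UNIV"
  proof (cases k)
    case 0
    then show ?thesis
      using Sb_has_sum[OF y] has_sum_imp_summable by simp
  next
    case (Suc j)
    have "fourier_term (\<lambda>g. of_real (b g ^ k) * ?a g) = (\<lambda>g. 0)"
      by (auto simp: Suc)
    then show ?thesis
      by simp
  qed
  show "fourier_term (\<lambda>g. of_real (inverse (b g) ^ k) * ?a g) summable_on {g. b g \<noteq> 0}"
    by (rule summable_on_0) simp
qed

lemma fourier_Sb:
  assumes "y \<in> Fn n b"
  shows "fourier (Sb b y) g = (if b g = 0 then fourier y g else 0)"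
  using fourier_has_sum[OF Sb_has_sum[OF assms]] by simp

section \<open>The generator on Fourier series\<close>

lemma has_vector_derivative_iff_quotient:
  "(f has_vector_derivative D) (at t) \<longleftrightarrow> ((\<lambda>h. (f (t + h) - f t) /\<^sub>R h) \<longlongrightarrow> D) (at 0)"
proof -
  have "((\<lambda>h. norm (f (t + h) - f t - h *\<^sub>R D) / norm h) \<longlongrightarrow> 0) (at 0)
      \<longleftrightarrow> ((\<lambda>h. norm ((f (t + h) - f t) /\<^sub>R h - D)) \<longlongrightarrow> 0) (at 0)"
  proof (rule filterlim_cong[OF refl refl])
    have "norm (f (t + h) - f t - h *\<^sub>R D) / norm h = norm ((f (t + h) - f t) /\<^sub>R h - D)"
      if "h \<noteq> 0" for h
    proof -
      have "(f (t + h) - f t) /\<^sub>R h - D = (f (t + h) - f t - h *\<^sub>R D) /\<^sub>R h"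
        using that by (simp add: scaleR_diff_right)
      then show ?thesis
        by (simp add: divide_inverse mult.commute)
    qed
    then show "\<forall>\<^sub>F h in at 0. norm (f (t + h) - f t - h *\<^sub>R D) / norm h
        = norm ((f (t + h) - f t) /\<^sub>R h - D)"
      by (simp add: eventually_at_filter)
  qed
  then show ?thesis
    unfolding has_vector_derivative_def has_derivative_at tendsto_norm_zero_iff
      LIM_zero_iff by (simp add: bounded_linear_scaleR_left)
qed

context real_character
begin

lemma fourier_conj_phase: "fourier (conj_phase b t x) g = cis (t * b g) * fourier x g"
proof -
  have "phase b s (basis 0) = basis 0" for s
    by (rule ell2_eqI) (simp add: coord_phase basis.rep_eq)
  then show ?thesis
    by (simp add: fourier_def conj_phase_apply coord_phase)
qed

lemma Fn_conj_phase:
  assumes "x \<in> Fn n b"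
  shows "conj_phase b t x \<in> Fn n b"
  using bounded_linear_conj_phase assms conj_phase_Cr[OF Fn_Cr[OF assms]]
  by (rule Fn_image) (simp add: fourier_conj_phase conj_phase_cscale_op conj_phase_lreg mult_ac)

lemma conj_phase_sum_has_vector_derivative:
  "((\<lambda>t. conj_phase b t (\<Sum>g\<in>F. fourier_term \<alpha> g)) has_vector_derivative
     conj_phase b t (\<Sum>g\<in>F. fourier_term (\<lambda>g. \<i> * b g * \<alpha> g) g)) (at t)"
proof -
  have sum: "conj_phase b t (\<Sum>g\<in>F. fourier_term \<alpha> g)
      = (\<Sum>g\<in>F. cscale_op (cis (t * b g)) (fourier_term \<alpha> g))" for t \<alpha>
    by (simp add: linear_sum[OF bounded_linear.linear[OF bounded_linear_conj_phase]]
        conj_phase_cscale_op conj_phase_lreg mult.commute)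
  have "((\<lambda>t. cscale_op (cis (t * b g)) (fourier_term \<alpha> g)) has_vector_derivative
      cscale_op (cis (t * b g)) (fourier_term (\<lambda>g. \<i> * b g * \<alpha> g) g)) (at t)" for g
  proof -
    have "((\<lambda>t. cis (t * b g)) has_vector_derivative b g *\<^sub>R (\<i> * cis (t * b g))) (at t)"
      unfolding has_vector_derivative_def
      by (rule derivative_eq_intros refl)+ (auto simp: mult_ac scaleR_conv_of_real)
    then have "((\<lambda>t. cscale_op (cis (t * b g)) (fourier_term \<alpha> g)) has_vector_derivative
        cscale_op (b g *\<^sub>R (\<i> * cis (t * b g))) (fourier_term \<alpha> g)) (at t)"
      by (rule bounded_linear.has_vector_derivative[OF
            bounded_bilinear.bounded_linear_left[OF bounded_bilinear_cscale_op]])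
    then show ?thesis
      by (simp add: scaleR_conv_of_real mult_ac)
  qed
  then show ?thesis
    unfolding sum by (intro has_vector_derivative_sum)
qed

text \<open>
  The mean value inequality for the partial sums, whose derivatives have constant norm because
  conjugation is isometric, passes to the limit. Allowing any index set \<open>A\<close> makes the bound apply
  to the tails of a series.
\<close>

lemma norm_conj_phase_diff_le:
  assumes x: "(fourier_term \<alpha> has_sum x) A" and y: "(fourier_term (\<lambda>g. \<i> * b g * \<alpha> g) has_sum y) A"
  shows "norm (conj_phase b t x - x) \<le> \<bar>t\<bar> * norm y"
proof (rule tendsto_le)
  let ?x = "sum (fourier_term \<alpha>)" and ?y = "sum (fourier_term (\<lambda>g. \<i> * b g * \<alpha> g))"
  have "norm (conj_phase b t (?x F) - conj_phase b 0 (?x F)) \<le> norm (?y F) * norm (t - 0)" for F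
  proof (rule differentiable_bound[of UNIV])
    show "((\<lambda>t. conj_phase b t (?x F)) has_derivative (\<lambda>h. h *\<^sub>R conj_phase b s (?y F)))
        (at s within UNIV)" for s
      using conj_phase_sum_has_vector_derivative[of \<alpha> F s] by (simp add: has_vector_derivative_def)
    show "onorm (\<lambda>h. h *\<^sub>R conj_phase b s (?y F)) \<le> norm (?y F)" for s
      by (rule onorm_le) (simp add: norm_conj_phase mult.commute)
  qed simp_all
  then show "\<forall>\<^sub>F F in finite_subsets_at_top A. norm (conj_phase b t (?x F) - ?x F) \<le> \<bar>t\<bar> * norm (?y F)"
    by (simp add: mult.commute)
  show "((\<lambda>F. norm (conj_phase b t (?x F) - ?x F)) \<longlongrightarrow> norm (conj_phase b t x - x)) (finite_subsets_at_top A)"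
    using x by (intro tendsto_intros bounded_linear.tendsto[OF bounded_linear_conj_phase])
      (simp_all add: has_sum_def)
  show "((\<lambda>F. \<bar>t\<bar> * norm (?y F)) \<longlongrightarrow> \<bar>t\<bar> * norm y) (finite_subsets_at_top A)"
    using y by (intro tendsto_intros) (simp_all add: has_sum_def)
qed simp

text \<open>
  The difference quotient of \<open>x\<close> is approximated by those of its partial sums uniformly in \<open>t\<close>, by
  \<open>norm_conj_phase_diff_le\<close> for the tails. This permits exchanging the limit along finite sets with
  the limit \<open>t \<rightarrow> 0\<close>.
\<close>

lemma conj_phase_generator:
  assumes x: "(fourier_term \<alpha> has_sum x) UNIV" and y: "(fourier_term (\<lambda>g. \<i> * b g * \<alpha> g) has_sum y) UNIV"
  shows "((\<lambda>t. (conj_phase b t x - x) /\<^sub>R t) \<longlongrightarrow> y) (at 0)"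
proof (rule swap_uniform_limit')
  interpret C: bounded_linear "conj_phase b t" for t
    by (rule bounded_linear_conj_phase)
  let ?x = "sum (fourier_term \<alpha>)" and ?y = "sum (fourier_term (\<lambda>g. \<i> * b g * \<alpha> g))"
  let ?q = "\<lambda>x t. (conj_phase b t x - x) /\<^sub>R t"
  show "\<forall>\<^sub>F F in finite_subsets_at_top UNIV. ((\<lambda>t. ?q (?x F) t) \<longlongrightarrow> ?y F) (at 0)"
    using conj_phase_sum_has_vector_derivative[of \<alpha> _ 0]
    by (simp add: has_vector_derivative_iff_quotient)
  show lim: "(?y \<longlongrightarrow> y) (finite_subsets_at_top UNIV)"
    using y by (simp add: has_sum_def)
  show "uniform_limit (- {0}) (\<lambda>F t. ?q (?x F) t) (?q x) (finite_subsets_at_top UNIV)"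
  proof (rule uniform_limitI)
    fix e :: real assume "e > 0"
    have near: "dist (?q (?x F) t) (?q x t) \<le> dist (?y F) y" if "finite F" "t \<noteq> 0" for F t
    proof -
      let ?r = "conj_phase b t (x - ?x F) - (x - ?x F)"
      have "norm ?r \<le> \<bar>t\<bar> * norm (y - ?y F)"
        using that by (intro norm_conj_phase_diff_le[where A = "UNIV - F" and \<alpha> = \<alpha>] has_sum_Diff x y) auto
      moreover have "?q (?x F) t - ?q x t = - (?r /\<^sub>R t)"
        by (simp add: C.diff algebra_simps)
      then have "dist (?q (?x F) t) (?q x t) = norm ?r / \<bar>t\<bar>"
        by (simp only: dist_norm norm_minus_cancel norm_scaleR) (simp add: divide_inverse)
      ultimately show ?thesis
        using that by (simp add: dist_norm norm_minus_commute divide_le_eq mult.commute)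
    qed
    have "\<forall>\<^sub>F F in finite_subsets_at_top UNIV. dist (?y F) y < e"
      using lim \<open>e > 0\<close> by (rule tendstoD)
    moreover have "\<forall>\<^sub>F F in finite_subsets_at_top (UNIV :: 'g set). finite F"
      by (rule eventually_finite_subsets_at_top_weakI) auto
    ultimately show "\<forall>\<^sub>F F in finite_subsets_at_top UNIV. \<forall>t\<in>- {0}. dist (?q (?x F) t) (?q x t) < e"
      by eventually_elim (auto intro: order_le_less_trans[OF near])
  qed
  show "\<forall>\<^sub>F t in at 0. t \<in> - {0 :: real}"
    by (simp add: eventually_at_filter)
qed simp

lemma gen_has_sum:
  assumes "x \<in> Fn (Suc n) b"
  shows "(fourier_term (\<lambda>g. \<i> * b g * fourier x g) has_sum gen b x) UNIV"
    and "((\<lambda>t. (conj_phase b t x - x) /\<^sub>R t) \<longlongrightarrow> gen b x) (at 0)"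
proof -
  have "(\<lambda>g. cscale_op \<i> (fourier_term (\<lambda>g. of_real (b g ^ 1) * fourier x g) g)) summable_on UNIV"
    using Fn_summable[OF assms, of 1] by (intro summable_on_cscale_op) simp
  then have "fourier_term (\<lambda>g. \<i> * b g * fourier x g) summable_on UNIV"
    by (simp add: mult_ac)
  then obtain y where y: "(fourier_term (\<lambda>g. \<i> * b g * fourier x g) has_sum y) UNIV"
    unfolding summable_on_def by blast
  note lim = conj_phase_generator[OF Fn_has_sum[OF assms] y]
  then have "gen b x = y"
    unfolding gen_def by (intro tendsto_Lim) (simp_all add: M_aut_eq Fn_Cr[OF assms])
  with y lim show "(fourier_term (\<lambda>g. \<i> * b g * fourier x g) has_sum gen b x) UNIV"
    "((\<lambda>t. (conj_phase b t x - x) /\<^sub>R t) \<longlongrightarrow> gen b x) (at 0)"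
    by simp_all
qed

lemma fourier_gen: "x \<in> Fn (Suc n) b \<Longrightarrow> fourier (gen b x) g = \<i> * b g * fourier x g"
  using fourier_has_sum[OF gen_has_sum(1)] by simp

text \<open>
  Multiplication of the coefficients by \<open>b g\<close> turns the weight \<open>b g ^ k\<close> into \<open>b g ^ Suc k\<close>, which
  costs one order, and \<open>inverse (b g) ^ Suc j\<close> into \<open>inverse (b g) ^ j\<close>.
\<close>

lemma gen_Fn:
  assumes x: "x \<in> Fn (Suc n) b"
  shows "gen b x \<in> Fn n b"
proof (rule Fn_intro[OF gen_has_sum(1)[OF x]])
  fix k assume k: "k \<le> n"
  have "(\<lambda>g. cscale_op \<i> (fourier_term (\<lambda>g. of_real (b g ^ Suc k) * fourier x g) g)) summable_on UNIV"
    using Fn_summable[OF x, of "Suc k"] k by (intro summable_on_cscale_op) simp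
  then show "fourier_term (\<lambda>g. of_real (b g ^ k) * (\<i> * b g * fourier x g)) summable_on UNIV"
    by (simp add: mult_ac)
  show "fourier_term (\<lambda>g. of_real (inverse (b g) ^ k) * (\<i> * b g * fourier x g)) summable_on {g. b g \<noteq> 0}"
  proof (cases k)
    case 0
    have "(\<lambda>g. cscale_op \<i> (fourier_term (\<lambda>g. of_real (b g ^ 1) * fourier x g) g)) summable_on {g. b g \<noteq> 0}"
      using Fn_summable_subset[OF x, of 1] by (intro summable_on_cscale_op) simp
    then show ?thesis
      by (simp add: 0 mult_ac)
  next
    case (Suc j)
    have "(\<lambda>g. cscale_op \<i> (fourier_term (\<lambda>g. of_real (inverse (b g) ^ j) * fourier x g) g)) summable_on {g. b g \<noteq> 0}"
      using Fn_summable_inverse[OF x, of j] k Suc by (intro summable_on_cscale_op) simp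
    also have "?this \<longleftrightarrow> ?thesis"
      by (rule summable_on_cong) (simp add: Suc field_simps)
    finally show ?thesis .
  qed
qed

text \<open>
  By the group law, the difference quotients at \<open>t\<close> are the images under \<open>conj_phase b t\<close> of those
  at \<open>0\<close>.
\<close>

lemma conj_phase_has_vector_derivative:
  assumes "x \<in> Fn (Suc n) b"
  shows "((\<lambda>t. conj_phase b t x) has_vector_derivative conj_phase b t (gen b x)) (at t)"
proof -
  interpret C: bounded_linear "conj_phase b t"
    by (rule bounded_linear_conj_phase)
  have "((\<lambda>h. conj_phase b t ((conj_phase b h x - x) /\<^sub>R h)) \<longlongrightarrow> conj_phase b t (gen b x)) (at 0)"
    by (rule C.tendsto[OF gen_has_sum(2)[OF assms]])
  then show ?thesis
    by (simp add: has_vector_derivative_iff_quotient C.scaleR C.diff conj_phase_conj_phase)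
qed

end

section \<open>The wave problem\<close>

theorem theorem4p1:
  fixes b :: "'g::group_add \<Rightarrow> real"
    and x0 y0 :: "'g op"
  assumes "countable (UNIV :: 'g set)"
    and "infinite (UNIV :: 'g set)"
    and "\<And>g h. b (g + h) = b g + b h"
    and "\<exists>g. b g \<noteq> 0"
    and "x0 \<in> Fn 2 b"
    and "y0 \<in> Fn 3 b"
  shows "wave_solution (wave_dom b) (wave_op b) x0 y0
    (\<lambda>t. t *\<^sub>R Sb b y0
       + (M_aut b t x0 + M_aut b (- t) x0) /\<^sub>R 2
       + cscale_op (1 / (2 * \<i>)) (M_aut b t (Tb b y0) - M_aut b (- t) (Tb b y0)))"
proof -
  interpret real_character b
    by unfold_locales (rule assms(3))
  note x0 = \<open>x0 \<in> Fn 2 b\<close>[unfolded numeral_2_eq_2] and y0 = \<open>y0 \<in> Fn 3 b\<close>[unfolded numeral_3_eq_3]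
  define z0 where "z0 = Tb b y0"
  have z0: "z0 \<in> Fn (Suc (Suc 0)) b"
    unfolding z0_def by (rule Tb_Fn[OF y0])
  note Cr_rules = Cr_add Cr_diff Cr_scaleR Cr_cscale conj_phase_Cr Fn_Cr
  note fourier_rules = fourier_add fourier_diff fourier_scaleR fourier_cscale_op fourier_conj_phase
  let ?E = "conj_phase b"
  let ?s = "Sb b y0" and ?x1 = "gen b x0" and ?z1 = "gen b z0"
  let ?x2 = "gen b ?x1" and ?z2 = "gen b ?z1"
  let ?c = "1 / (2 * \<i>)"
  define u where "u t = t *\<^sub>R ?s + (?E t x0 + ?E (- t) x0) /\<^sub>R 2
    + cscale_op ?c (?E t z0 - ?E (- t) z0)" for t
  define u' where "u' t = ?s + (?E t ?x1 - ?E (- t) ?x1) /\<^sub>R 2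
    + cscale_op ?c (?E t ?z1 + ?E (- t) ?z1)" for t
  define u'' where "u'' t = (?E t ?x2 + ?E (- t) ?x2) /\<^sub>R 2
    + cscale_op ?c (?E t ?z2 - ?E (- t) ?z2)" for t
  have x1: "?x1 \<in> Fn (Suc 0) b" and z1: "?z1 \<in> Fn (Suc 0) b"
    by (intro gen_Fn x0 z0)+
  have x2: "?x2 \<in> Fn 0 b" and z2: "?z2 \<in> Fn 0 b"
    by (intro gen_Fn x1 z1)+
  have s: "?s \<in> Fn n b" for n
    by (rule Sb_Fn[OF y0])
  have fs: "fourier ?s g = (if b g = 0 then fourier y0 g else 0)" for g
    by (rule fourier_Sb[OF y0])
  have fz: "fourier z0 g = of_real (inverse (b g)) * fourier y0 g" for g
    unfolding z0_def by (rule fourier_Tb[OF y0])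
  have u_Fn: "u t \<in> Fn (Suc (Suc 0)) b" for t
    unfolding u_def by (intro Fn_add Fn_diff Fn_scaleR Fn_cscale Fn_conj_phase s x0 z0)
  have deriv: "((\<lambda>t. ?E t x) has_vector_derivative ?E t (gen b x)) (at t)"
    "((\<lambda>t. ?E (- t) x) has_vector_derivative - ?E (- t) (gen b x)) (at t)"
    if "x \<in> Fn (Suc 0) b" for x t
  proof -
    show *: "((\<lambda>t. ?E t x) has_vector_derivative ?E t (gen b x)) (at t)" for t
      by (rule conj_phase_has_vector_derivative[OF that])
    have "(uminus has_vector_derivative - 1) (at t)"
      by (auto intro!: derivative_eq_intros)
    from vector_diff_chain_at[OF this *]
    show "((\<lambda>t. ?E (- t) x) has_vector_derivative - ?E (- t) (gen b x)) (at t)"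
      by (simp add: o_def)
  qed
  note derivs = deriv has_vector_derivative_add has_vector_derivative_diff
    bounded_linear.has_vector_derivative[OF bounded_linear_cscale_op]
    bounded_linear.has_vector_derivative[OF bounded_linear_scaleR_right]
  \<comment> \<open>The formula for \<open>u\<close> makes sense for all real \<open>t\<close>, so the initial conditions follow from
    differentiability at \<open>0\<close>.\<close>
  have du: "(u has_vector_derivative u' t) (at t)" for t
  proof -
    have "((\<lambda>t. t *\<^sub>R ?s) has_vector_derivative ?s) (at t)"
      by (auto intro!: derivative_eq_intros)
    then have "(u has_vector_derivative ?s + (?E t ?x1 + - ?E (- t) ?x1) /\<^sub>R 2
        + cscale_op ?c (?E t ?z1 - - ?E (- t) ?z1)) (at t)"
      unfolding u_def using Fn_mono[OF x0] Fn_mono[OF z0] by (intro derivs) simp_all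
    then show ?thesis
      by (simp add: u'_def)
  qed
  have du': "(u' has_vector_derivative u'' t) (at t)" for t
  proof -
    have "(u' has_vector_derivative 0 + (?E t ?x2 - - ?E (- t) ?x2) /\<^sub>R 2
        + cscale_op ?c (?E t ?z2 + - ?E (- t) ?z2)) (at t)"
      unfolding u'_def by (intro derivs x1 z1 has_vector_derivative_const)
    then show ?thesis
      by (simp add: u''_def)
  qed
  have wave: "u'' t = wave_op b (u t)" for t
  proof (rule Cr_eqI)
    show "u'' t \<in> Cr"
      unfolding u''_def using x2 z2 by (intro Cr_rules)
    show "wave_op b (u t) \<in> Cr"
      unfolding wave_op_def o_def by (rule Fn_Cr[OF gen_Fn[OF gen_Fn[OF u_Fn]]])
    fix g
    have "fourier (wave_op b (u t)) g = (\<i> * b g) * ((\<i> * b g) * fourier (u t) g)"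
      by (simp add: wave_op_def fourier_gen[OF gen_Fn[OF u_Fn]] fourier_gen[OF u_Fn])
    also have "\<dots> = fourier (u'' t) g"
      unfolding u_def u''_def
      by (simp add: fourier_rules fs fourier_gen[OF x1] fourier_gen[OF z1]
          fourier_gen[OF x0] fourier_gen[OF z0]) (simp add: field_simps)
    finally show "fourier (u'' t) g = fourier (wave_op b (u t)) g" ..
  qed
  have u0: "u 0 = x0"
    by (simp add: u_def flip: scaleR_2)
  have u'0: "u' 0 = y0"
  proof (rule Cr_eqI)
    show "u' 0 \<in> Cr"
      unfolding u'_def using x1 z1 s by (intro Cr_rules)
    show "y0 \<in> Cr"
      by (rule Fn_Cr[OF y0])
    \<comment> \<open>The kernel part comes from \<open>Sb\<close>; off the kernel, \<open>b g\<close> cancels against \<open>inverse (b g)\<close>.\<close>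
    show "fourier (u' 0) g = fourier y0 g" for g
      by (simp add: u'_def fourier_rules fs fourier_gen[OF z0] fz)
  qed
  have lim: "((\<lambda>t. norm (f t - f 0)) \<longlongrightarrow> 0) (at_right 0)"
    if "(f has_vector_derivative D) (at 0)" for f :: "real \<Rightarrow> 'g op" and D
  proof -
    have "(f \<longlongrightarrow> f 0) (at_right 0)"
      using has_vector_derivative_continuous[OF that] filterlim_at_split
      by (auto simp: continuous_at filterlim_at_split isCont_def)
    then show ?thesis
      by (simp add: LIM_zero_iff tendsto_norm_zero_iff)
  qed
  have "wave_solution (wave_dom b) (wave_op b) x0 y0 u"
    unfolding wave_solution_def wave_dom_def numeral_2_eq_2
  proof (intro conjI allI impI)
    show "((\<lambda>t. norm (u t - x0)) \<longlongrightarrow> 0) (at_right 0)"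
      using lim[OF du] by (simp add: u0)
    have "((\<lambda>t. norm (u' t - y0)) \<longlongrightarrow> 0) (at_right 0)"
      using lim[OF du'] by (simp add: u'0)
    then show "\<exists>u' u''. (\<forall>t>0. (u has_vector_derivative u' t) (at t)) \<and>
        (\<forall>t>0. (u' has_vector_derivative u'' t) (at t)) \<and>
        (\<forall>t>0. u'' t = wave_op b (u t)) \<and>
        ((\<lambda>t. norm (u' t - y0)) \<longlongrightarrow> 0) (at_right 0)"
      using du du' by - (rule exI[of _ u'], rule exI[of _ u''], simp add: wave)
  qed (rule Fn_Cr[OF u_Fn] u_Fn u0)+
  moreover have "u = (\<lambda>t. t *\<^sub>R Sb b y0 + (M_aut b t x0 + M_aut b (- t) x0) /\<^sub>R 2
       + cscale_op ?c (M_aut b t (Tb b y0) - M_aut b (- t) (Tb b y0)))"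
    by (simp add: fun_eq_iff u_def M_aut_eq Fn_Cr[OF x0] Fn_Cr[OF z0] z0_def[symmetric])
  ultimately show ?thesis
    by simp
qed

end
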